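(* Let $\omega\in C(\mathbb{T})$ be a weight function such that, for some $\epsilon>0$, $\omega$ is decreasing on $(-\epsilon,0)$, $\omega(0)=0$, $\omega$ is increasing on $(0,\epsilon)$, and moreover $$\limsup_{t\to0}\frac{\log\omega(rt)}{\log\omega(t)}=\infty\quad\text{for some } r\in(0,1).$$ Then for each $0<p\le\infty$ there exist a sequence of positive integers $K_n\to\infty$ as $n\to\infty$ and a sequence of trigonometric polynomials $Q_n$ of degree at most $K_n$ such that $$\lim_{n\to\infty}\frac{\|Q_n'\|_{L_p(\omega)}}{K_n\|Q_n\|_{L_p(\omega)}}=\infty.$$
   Context: $\mathbb{T}=\mathbb{R}/2\pi\mathbb{Z}$. A weight is a nonnegative integrable function on $\mathbb{T}$. $\|f\|_{L_p(\omega)}=\left(\int_{\mathbb{T}}|f|^p\omega\right)^{1/p}$ if $0<p<\infty$, and $\|f\|_{L_\infty(\omega)}=\operatorname{ess\,sup}_{t\in\mathbb{T}}|f(t)\omega(t)|$. As is implicit in the use of $\log\omega$, $\omega(t)>0$ for $t\neq 0$ near $0$. *)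

theory Defs
  imports "HOL-Analysis.Analysis" "HOL-Probability.Essential_Supremum"
begin

text \<open>Functions on \<open>\<real>/2\<pi>\<int>\<close> are represented by \<open>2\<pi>\<close>-periodic functions on \<open>\<real>\<close>; integrals and
  essential suprema over the circle are taken over the period \<open>[-\<pi>, \<pi>]\<close>.\<close>

definition circle_fun :: "(real \<Rightarrow> real) \<Rightarrow> bool" where
  "circle_fun f \<longleftrightarrow> (\<forall>t. f (t + 2 * pi) = f t)"

definition circle_measure :: "real measure" where
  "circle_measure = restrict_space lborel {-pi..pi}"

definition weight :: "(real \<Rightarrow> real) \<Rightarrow> bool" where
  "weight \<omega> \<longleftrightarrow> circle_fun \<omega> \<and> (\<forall>t. 0 \<le> \<omega> t) \<and> integrable circle_measure \<omega>"

text \<open>For \<open>p = \<infinity>\<close> the weight multiplies the function inside the essential supremum.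
  The value is real: it is junk (\<open>0\<close>) where the mathematical (quasi)norm is infinite, which cannot
  happen for a bounded measurable function if the weight is bounded and measurable.\<close>

definition Lp_norm :: "ennreal \<Rightarrow> (real \<Rightarrow> real) \<Rightarrow> (real \<Rightarrow> real) \<Rightarrow> real" where
  "Lp_norm p \<omega> f =
     (if p = \<infinity> then real_of_ereal (esssup circle_measure (\<lambda>t. ereal \<bar>f t * \<omega> t\<bar>))
      else (\<integral>t. \<bar>f t\<bar> powr enn2real p * \<omega> t \<partial>circle_measure) powr (1 / enn2real p))"

definition trig_polys :: "nat \<Rightarrow> (real \<Rightarrow> real) set" where
  "trig_polys N =
     {T. \<exists>a b :: nat \<Rightarrow> real.
           T = (\<lambda>t. a 0 + (\<Sum>k=1..N. a k * cos (real k * t) + b k * sin (real k * t)))}"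

end

theory Submission
  imports Defs
begin

text \<open>Why the Bernstein inequality fails. Suppose that \<open>\<parallel>Q'\<parallel> \<le> C K \<parallel>Q\<parallel>\<close> held for all trigonometric
  polynomials of every large degree \<open>K\<close>. All derivatives of \<open>Q\<close> have the same degree, so that
  \<open>\<parallel>Q\<^sup>(\<^sup>k\<^sup>)\<parallel> \<le> (C K)\<^sup>k \<parallel>Q\<parallel>\<close>, and Taylor's formula yields a translation estimate: the values of \<open>Q\<close> at
  \<open>x + h\<close>, weighted by \<open>\<omega> x\<close> and not by \<open>\<omega> (x + h)\<close>, have norm at most
  \<open>exp (O(C K \<bar>h\<bar>)) \<parallel>Q\<parallel>\<close> (lemmas \<open>translation_estimate_finite\<close> and
  \<open>translation_estimate_infinity\<close>).

  The hypothesis on \<open>ln \<omega>\<close> contradicts this. By \<open>drop_at_any_ratio\<close> there are arbitrarily small \<open>t\<close>,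
  all on the same side of \<open>0\<close>, with \<open>\<omega> s \<le> \<omega> t powr M\<close> for a point \<open>s < t\<close> as close to \<open>t\<close>, relative
  to its size, as desired, and with \<open>M\<close> as large as desired. So on \<open>[0, s]\<close> the weight is
  negligible compared with \<open>\<omega> t = exp (- A)\<close>, and a polynomial may be as large as \<open>exp (M A)\<close>
  there without affecting its norm. Such a polynomial is obtained by composing a Dirichlet kernel
  with an affine image of the cosine: it is bounded by 1 outside \<open>[0, s]\<close> and behaves like a
  Chebyshev polynomial beyond \<open>[-1, 1]\<close> inside. Its logarithm therefore grows like the square root
  of the distance to the end of the arc: at depth \<open>\<eta> s\<close> it is of order \<open>\<surd>\<eta> K s\<close>
  (lemma \<open>bump_lower\<close>), whereas translating from there to \<open>t\<close> costs only \<open>O(C \<eta> K s)\<close>. If \<open>\<eta>\<close> is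
  small in terms of \<open>C\<close>, and \<open>K s\<close> is comparable to \<open>M A\<close> with \<open>M\<close> large in terms of \<open>\<eta>\<close>, then
  the translation estimate fails at \<open>t\<close> by a factor \<open>exp A\<close>, which is unbounded as \<open>t\<close> tends to
  \<open>0\<close> (lemma \<open>translation_estimate_contradicts_drops\<close>).

  For \<open>p < \<infinity>\<close> the contradiction also has to survive the change of scale: the translated bump is
  seen by the weight on an interval of length of order \<open>s\<close> only, and \<open>s\<close> may be far smaller than
  \<open>exp (- M A)\<close>. A power of the bump is therefore used that decays away from the arc at least like
  \<open>(s / \<bar>x\<bar>)\<^sup>2\<close> after raising it to the power \<open>p\<close> (lemma \<open>bump_decay\<close>), which makes its norm of
  the same order in \<open>s\<close>. This is also the reason for the Dirichlet kernel instead of a single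
  Chebyshev polynomial.\<close>

section \<open>The algebra of trigonometric polynomials\<close>

lemma trig_polys_iff:
  "T \<in> trig_polys N \<longleftrightarrow>
    (\<exists>a b. T = (\<lambda>t. \<Sum>k\<le>N. a k * cos (real k * t) + b k * sin (real k * t)))"
proof -
  have "(\<Sum>k\<le>N. a k * cos (real k * t) + b k * sin (real k * t)) =
        a 0 + (\<Sum>k=1..N. a k * cos (real k * t) + b k * sin (real k * t))" for a b :: "nat \<Rightarrow> real" and t
    unfolding atMost_atLeast0 by (subst sum.atLeast_Suc_atMost) auto
  then show ?thesis unfolding trig_polys_def by simp
qed

lemma trig_polys_monomial:
  assumes "k \<le> N"
  shows "(\<lambda>t. c * cos (real k * t) + d * sin (real k * t)) \<in> trig_polys N"
  unfolding trig_polys_iff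
proof (rule exI[of _ "\<lambda>i. if i = k then c else 0"], rule exI[of _ "\<lambda>i. if i = k then d else 0"], rule ext)
  fix t
  have "(\<Sum>i\<le>N. (if i = k then c else 0) * cos (real i * t) + (if i = k then d else 0) * sin (real i * t)) =
      (\<Sum>i\<le>N. (if i = k then c * cos (real k * t) + d * sin (real k * t) else 0))"
    by (intro sum.cong) auto
  also have "\<dots> = c * cos (real k * t) + d * sin (real k * t)"
    using assms by (subst sum.delta) auto
  finally show "c * cos (real k * t) + d * sin (real k * t) =
    (\<Sum>i\<le>N. (if i = k then c else 0) * cos (real i * t) + (if i = k then d else 0) * sin (real i * t))"
    by (rule sym)
qed

lemma trig_polys_const: "(\<lambda>t. c) \<in> trig_polys N"
  using trig_polys_monomial[of 0 N c 0] by simp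

lemma trig_polys_add:
  assumes "f \<in> trig_polys N" "g \<in> trig_polys N"
  shows "(\<lambda>t. f t + g t) \<in> trig_polys N"
proof -
  obtain a b where f: "f = (\<lambda>t. \<Sum>k\<le>N. a k * cos (real k * t) + b k * sin (real k * t))"
    using assms unfolding trig_polys_iff by auto
  obtain c d where g: "g = (\<lambda>t. \<Sum>k\<le>N. c k * cos (real k * t) + d k * sin (real k * t))"
    using assms unfolding trig_polys_iff by auto
  show ?thesis unfolding trig_polys_iff f g
    by (rule exI[of _ "\<lambda>k. a k + c k"], rule exI[of _ "\<lambda>k. b k + d k"])
       (simp add: sum.distrib distrib_right add_ac)
qed

lemma trig_polys_sum:
  assumes "\<And>i. i \<in> A \<Longrightarrow> f i \<in> trig_polys N"
  shows "(\<lambda>t. \<Sum>i\<in>A. f i t) \<in> trig_polys N"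
proof (cases "finite A")
  case True
  then show ?thesis using assms
  proof (induction A rule: finite_induct)
    case empty
    then show ?case by (simp add: trig_polys_const)
  next
    case (insert x F)
    then have "(\<lambda>t. f x t + (\<Sum>i\<in>F. f i t)) \<in> trig_polys N" by (intro trig_polys_add) auto
    with insert.hyps show ?case by simp
  qed
qed (simp add: trig_polys_const)

lemma trig_polys_monomial_mult:
  assumes "i + j \<le> N"
  shows "(\<lambda>t. (a * cos (real i * t) + b * sin (real i * t)) *
              (c * cos (real j * t) + d * sin (real j * t))) \<in> trig_polys N"
proof -
  have *: "(\<lambda>t. (a * cos (real i * t) + b * sin (real i * t)) *
              (c * cos (real j * t) + d * sin (real j * t))) \<in> trig_polys N"
    if ij: "i + j \<le> N" "j \<le> i" for i j a b c d
  proof -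
    have in_N: "(\<lambda>t. (((a*c - b*d)/2) * cos (real (i+j) * t) + ((a*d + b*c)/2) * sin (real (i+j) * t))
      + (((a*c + b*d)/2) * cos (real (i-j) * t) + ((b*c - a*d)/2) * sin (real (i-j) * t))) \<in> trig_polys N"
      by (intro trig_polys_add trig_polys_monomial) (use ij in auto)
    have eq: "(\<lambda>t. (((a*c - b*d)/2) * cos (real (i+j) * t) + ((a*d + b*c)/2) * sin (real (i+j) * t))
      + (((a*c + b*d)/2) * cos (real (i-j) * t) + ((b*c - a*d)/2) * sin (real (i-j) * t))) =
      (\<lambda>t. (a * cos (real i * t) + b * sin (real i * t)) *
              (c * cos (real j * t) + d * sin (real j * t)))"
    proof
      fix t
      have p: "cos (real (i+j) * t) = cos (real i * t) * cos (real j * t) - sin (real i * t) * sin (real j * t)"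
        "sin (real (i+j) * t) = sin (real i * t) * cos (real j * t) + cos (real i * t) * sin (real j * t)"
        by (simp_all add: distrib_right cos_add sin_add)
      have m: "cos (real (i-j) * t) = cos (real i * t) * cos (real j * t) + sin (real i * t) * sin (real j * t)"
        "sin (real (i-j) * t) = sin (real i * t) * cos (real j * t) - cos (real i * t) * sin (real j * t)"
        using ij by (simp_all add: of_nat_diff left_diff_distrib cos_diff sin_diff)
      show "(((a*c - b*d)/2) * cos (real (i+j) * t) + ((a*d + b*c)/2) * sin (real (i+j) * t))
        + (((a*c + b*d)/2) * cos (real (i-j) * t) + ((b*c - a*d)/2) * sin (real (i-j) * t)) =
        (a * cos (real i * t) + b * sin (real i * t)) * (c * cos (real j * t) + d * sin (real j * t))"
        unfolding p m by (simp add: field_simps)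
    qed
    show ?thesis using in_N unfolding eq .
  qed
  show ?thesis
  proof (cases "j \<le> i")
    case True then show ?thesis using * assms by blast
  next
    case False
    then show ?thesis using *[of j i c d a b] assms by (simp add: mult.commute add.commute)
  qed
qed

lemma trig_polys_mult:
  assumes "f \<in> trig_polys M" "g \<in> trig_polys N" "M + N \<le> L"
  shows "(\<lambda>t. f t * g t) \<in> trig_polys L"
proof -
  obtain a b where f: "f = (\<lambda>t. \<Sum>k\<le>M. a k * cos (real k * t) + b k * sin (real k * t))"
    using assms unfolding trig_polys_iff by auto
  obtain c d where g: "g = (\<lambda>t. \<Sum>k\<le>N. c k * cos (real k * t) + d k * sin (real k * t))"
    using assms unfolding trig_polys_iff by auto
  show ?thesis unfolding f g sum_product
    by (intro trig_polys_sum trig_polys_monomial_mult) (use assms(3) in auto)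
qed

lemma trig_polys_power:
  assumes "f \<in> trig_polys M"
  shows "(\<lambda>t. f t ^ n) \<in> trig_polys (n * M)"
  by (induction n) (auto intro: trig_polys_const trig_polys_mult[OF assms])

lemma trig_polys_reflect:
  assumes "f \<in> trig_polys N"
  shows "(\<lambda>t. f (- t)) \<in> trig_polys N"
proof -
  obtain a b where f: "f = (\<lambda>t. \<Sum>k\<le>N. a k * cos (real k * t) + b k * sin (real k * t))"
    using assms unfolding trig_polys_iff by auto
  show ?thesis unfolding trig_polys_iff f
    by (rule exI[of _ a], rule exI[of _ "\<lambda>k. - b k"]) simp
qed

text \<open>Each derivative shifts the phase of the \<open>j\<close>-th harmonic by \<open>\<pi>/2\<close> and multiplies it by \<open>j\<close>.\<close>

lemma trig_polys_derivatives:
  assumes "Q \<in> trig_polys N"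
  obtains D :: "nat \<Rightarrow> real \<Rightarrow> real" and B where
    "D 0 = Q" "\<And>k. D k \<in> trig_polys N"
    "\<And>k x. (D k has_real_derivative D (Suc k) x) (at x)"
    "\<And>k x. \<bar>D k x\<bar> \<le> B * real N ^ k"
proof -
  obtain a b where Q: "Q = (\<lambda>t. \<Sum>k\<le>N. a k * cos (real k * t) + b k * sin (real k * t))"
    using assms unfolding trig_polys_iff by auto
  define D where "D = (\<lambda>k t. \<Sum>j\<le>N. real j ^ k *
    (a j * cos (real j * t + real k * (pi/2)) + b j * sin (real j * t + real k * (pi/2))))"
  define B where "B = (\<Sum>j\<le>N. \<bar>a j\<bar> + \<bar>b j\<bar>)"
  have 0: "D 0 = Q" unfolding D_def Q by simp
  have 1: "D k \<in> trig_polys N" for k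
    unfolding D_def
  proof (rule trig_polys_sum)
    fix j assume "j \<in> {..N}"
    then have "(\<lambda>t. (real j ^ k * (a j * cos (real k * (pi/2)) + b j * sin (real k * (pi/2)))) * cos (real j * t)
       + (real j ^ k * (b j * cos (real k * (pi/2)) - a j * sin (real k * (pi/2)))) * sin (real j * t)) \<in> trig_polys N"
      by (intro trig_polys_monomial) auto
    then show "(\<lambda>t. real j ^ k * (a j * cos (real j * t + real k * (pi/2)) +
        b j * sin (real j * t + real k * (pi/2)))) \<in> trig_polys N"
      by (simp add: cos_add sin_add algebra_simps)
  qed
  have 2: "(D k has_real_derivative D (Suc k) x) (at x)" for k x
  proof -
    have shift: "real j * x + real (Suc k) * (pi/2) = (real j * x + real k * (pi/2)) + pi/2" for j
      by (simp add: field_simps)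
    have s: "sin (y + pi/2) = cos y" "cos (y + pi/2) = - sin y" for y :: real
      by (simp_all add: sin_add cos_add)
    show ?thesis
      unfolding D_def shift s
      by (auto intro!: derivative_eq_intros sum.cong simp: algebra_simps)
  qed
  have 3: "\<bar>D k x\<bar> \<le> B * real N ^ k" for k x
  proof -
    have "\<bar>D k x\<bar> \<le> (\<Sum>j\<le>N. real N ^ k * (\<bar>a j\<bar> + \<bar>b j\<bar>))"
      unfolding D_def
    proof (intro order.trans[OF sum_abs] sum_mono)
      fix j assume j: "j \<in> {..N}"
      let ?y = "real j * x + real k * (pi/2)"
      have "\<bar>a j * cos ?y\<bar> \<le> \<bar>a j\<bar> * 1" "\<bar>b j * sin ?y\<bar> \<le> \<bar>b j\<bar> * 1"
        unfolding abs_mult by (intro mult_left_mono; simp)+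
      then have "\<bar>a j * cos ?y + b j * sin ?y\<bar> \<le> \<bar>a j\<bar> + \<bar>b j\<bar>" by linarith
      moreover have "real j ^ k \<le> real N ^ k" using j by (intro power_mono) auto
      ultimately show "\<bar>real j ^ k * (a j * cos ?y + b j * sin ?y)\<bar> \<le> real N ^ k * (\<bar>a j\<bar> + \<bar>b j\<bar>)"
        unfolding abs_mult by (intro mult_mono) auto
    qed
    then show ?thesis by (simp add: B_def sum_distrib_left mult.commute)
  qed
  show thesis using that 0 1 2 3 by blast
qed

lemma trig_polys_continuous:
  assumes "Q \<in> trig_polys N" shows "continuous_on A Q"
  using assms unfolding trig_polys_iff by (auto intro!: continuous_intros)

lemma trig_polys_differentiable:
  assumes "Q \<in> trig_polys N" shows "(Q has_real_derivative deriv Q x) (at x)"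
proof -
  obtain D B where D: "D 0 = Q" "\<And>k. D k \<in> trig_polys N"
    "\<And>k x. (D k has_real_derivative D (Suc k) x) (at x)" "\<And>k x. \<bar>D k x\<bar> \<le> B * real N ^ k"
    by (rule trig_polys_derivatives[OF assms]) blast
  show ?thesis using D(3)[of 0 x] by (simp add: D(1) DERIV_imp_deriv)
qed

lemma trig_polys_deriv:
  assumes "Q \<in> trig_polys N" shows "deriv Q \<in> trig_polys N"
proof -
  obtain D B where D: "D 0 = Q" "\<And>k. D k \<in> trig_polys N"
    "\<And>k x. (D k has_real_derivative D (Suc k) x) (at x)" "\<And>k x. \<bar>D k x\<bar> \<le> B * real N ^ k"
    by (rule trig_polys_derivatives[OF assms]) blast
  have "deriv Q = D (Suc 0)" using DERIV_imp_deriv[OF D(3)[of 0]] by (auto simp: D(1))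
  then show ?thesis using D(2) by simp
qed

lemma trig_polys_deriv_iter:
  assumes "Q \<in> trig_polys N" shows "(deriv ^^ k) Q \<in> trig_polys N"
  by (induction k) (auto intro: assms trig_polys_deriv)

text \<open>Taylor's formula, truncated with an error uniform in the base point; the remainder after
  \<open>n\<close> terms is \<open>O((N\<bar>h\<bar>)\<^sup>n/n!)\<close> because each derivative costs at most a factor \<open>N\<close>.\<close>

lemma trig_polys_taylor:
  assumes Q: "Q \<in> trig_polys N" and "0 < \<delta>"
  shows "\<exists>n. \<forall>x. \<bar>Q (x + h)\<bar> \<le> (\<Sum>k<n. \<bar>(deriv ^^ k) Q x\<bar> * (\<bar>h\<bar> ^ k / fact k)) + \<delta>"
proof -
  obtain D B where D: "D 0 = Q" "\<And>k. D k \<in> trig_polys N"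
    "\<And>k x. (D k has_real_derivative D (Suc k) x) (at x)" "\<And>k x. \<bar>D k x\<bar> \<le> B * real N ^ k"
    by (rule trig_polys_derivatives[OF Q]) blast
  have iter: "(deriv ^^ k) Q = D k" for k
  proof (induction k)
    case (Suc k)
    then show ?case using DERIV_imp_deriv[OF D(3)[of k]] by auto
  qed (simp add: D)
  have "(\<lambda>n. B * (inverse (fact n) * (real N * \<bar>h\<bar>) ^ n)) \<longlonglongrightarrow> B * 0"
    by (intro tendsto_mult_left summable_LIMSEQ_zero summable_exp)
  then have "\<forall>\<^sub>F n in sequentially. B * (inverse (fact n) * (real N * \<bar>h\<bar>) ^ n) < \<delta>"
    using \<open>0 < \<delta>\<close> by (intro order_tendstoD) auto
  then obtain n where n: "B * (inverse (fact n) * (real N * \<bar>h\<bar>) ^ n) < \<delta>"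
    by (auto simp: eventually_sequentially)
  have "\<bar>Q (x + h)\<bar> \<le> (\<Sum>k<n. \<bar>(deriv ^^ k) Q x\<bar> * (\<bar>h\<bar> ^ k / fact k)) + \<delta>" for x
  proof -
    have "\<exists>t. \<bar>t\<bar> \<le> \<bar>h\<bar> \<and> (\<lambda>u. D 0 (x + u)) h =
        (\<Sum>m<n. ((\<lambda>k u. D k (x + u)) m 0 / fact m) * h ^ m) + ((\<lambda>k u. D k (x + u)) n t / fact n) * h ^ n"
    proof (rule Maclaurin_all_le[of "\<lambda>k u. D k (x + u)"])
      have "((\<lambda>u. D m (x + u)) has_real_derivative D (Suc m) (x + u) * 1) (at u)" for m u
        by (rule DERIV_chain2[OF D(3)]) (auto intro!: derivative_eq_intros)
      then show "\<forall>m u. ((\<lambda>u. D m (x + u)) has_real_derivative D (Suc m) (x + u)) (at u)"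
        by simp
    qed simp
    then obtain t where t: "Q (x + h) = (\<Sum>m<n. (D m x / fact m) * h ^ m) + (D n (x + t) / fact n) * h ^ n"
      unfolding D(1) by auto
    have "\<bar>(D n (x + t) / fact n) * h ^ n\<bar> = \<bar>D n (x+t)\<bar> * (\<bar>h\<bar> ^ n / fact n)"
      by (simp add: abs_mult power_abs)
    also have "\<dots> \<le> (B * real N ^ n) * (\<bar>h\<bar> ^ n / fact n)"
      by (intro mult_right_mono D) auto
    also have "\<dots> = B * (inverse (fact n) * (real N * \<bar>h\<bar>) ^ n)"
      by (simp add: field_simps power_mult_distrib)
    also have "\<dots> \<le> \<delta>" using n by simp
    finally have r: "\<bar>(D n (x + t) / fact n) * h ^ n\<bar> \<le> \<delta>" .
    have "\<bar>\<Sum>m<n. (D m x / fact m) * h ^ m\<bar> \<le> (\<Sum>m<n. \<bar>D m x\<bar> * (\<bar>h\<bar> ^ m / fact m))"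
      by (intro order.trans[OF sum_abs] sum_mono) (simp add: abs_mult power_abs)
    with r show ?thesis unfolding t iter by linarith
  qed
  then show ?thesis by blast
qed

section \<open>The Dirichlet kernel as a polynomial in the cosine\<close>

fun chebyshev :: "nat \<Rightarrow> real \<Rightarrow> real" where
  "chebyshev 0 z = 1"
| "chebyshev (Suc 0) z = z"
| "chebyshev (Suc (Suc n)) z = 2 * z * chebyshev (Suc n) z - chebyshev n z"

lemma chebyshev_cos: "chebyshev n (cos \<phi>) = cos (real n * \<phi>)"
proof (induction n "cos \<phi>" rule: chebyshev.induct)
  case (3 n)
  have "cos (real n * \<phi>) = cos (real (Suc n) * \<phi> - \<phi>)" by (simp add: algebra_simps)
  moreover have "cos (real (Suc (Suc n)) * \<phi>) = cos (real (Suc n) * \<phi> + \<phi>)" by (simp add: algebra_simps)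
  ultimately show ?case using 3 by (simp only: chebyshev.simps cos_add cos_diff) (simp add: algebra_simps)
qed simp_all

lemma chebyshev_cosh: "chebyshev n (cosh \<theta>) = cosh (real n * \<theta>)"
proof (induction n "cosh \<theta>" rule: chebyshev.induct)
  case (3 n)
  have "cosh (real n * \<theta>) = cosh (real (Suc n) * \<theta> - \<theta>)" by (simp add: algebra_simps)
  moreover have "cosh (real (Suc (Suc n)) * \<theta>) = cosh (real (Suc n) * \<theta> + \<theta>)" by (simp add: algebra_simps)
  ultimately show ?case using 3 by (simp only: chebyshev.simps cosh_add cosh_diff) (simp add: algebra_simps)
qed simp_all

lemma chebyshev_trig_polys:
  assumes Z: "Z \<in> trig_polys 1"
  shows "(\<lambda>t. chebyshev n (Z t)) \<in> trig_polys n"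
proof (induction n rule: induct_nat_012)
  case 0
  then show ?case by (simp add: trig_polys_const)
next
  case 1
  then show ?case using Z by simp
next
  case (ge2 n)
  have a: "(\<lambda>t. 2 * (Z t * chebyshev (Suc n) (Z t))) \<in> trig_polys (Suc (Suc n))"
    by (intro trig_polys_mult[OF trig_polys_const[of _ 0]] trig_polys_mult[OF Z ge2(2)]) auto
  have b: "(\<lambda>t. (-1) * chebyshev n (Z t)) \<in> trig_polys (Suc (Suc n))"
    by (rule trig_polys_mult[OF trig_polys_const[of _ 0] ge2(1)]) auto
  show ?case using trig_polys_add[OF a b] by (simp add: mult.assoc)
qed

text \<open>With \<open>z = cos \<phi>\<close> this is the Dirichlet kernel at \<open>\<phi>\<close>, divided by its maximum
  \<open>2m + 1\<close>.\<close>

definition dirichlet :: "nat \<Rightarrow> real \<Rightarrow> real" where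
  "dirichlet m z = (1 + 2 * (\<Sum>k=1..m. chebyshev k z)) / (2 * real m + 1)"

lemma dirichlet_trig_polys:
  assumes "Z \<in> trig_polys 1"
  shows "(\<lambda>t. dirichlet m (Z t)) \<in> trig_polys m"
proof -
  have mono: "f \<in> trig_polys m" if "f \<in> trig_polys k" "k \<le> m" for f k
    using trig_polys_mult[OF trig_polys_const[of 1 0] that(1), of m] that(2) by simp
  have "(\<lambda>t. \<Sum>k=1..m. chebyshev k (Z t)) \<in> trig_polys m"
    by (intro trig_polys_sum mono[OF chebyshev_trig_polys[OF assms]]) auto
  then have "(\<lambda>t. (1 / (2 * real m + 1)) * (1 + 2 * (\<Sum>k=1..m. chebyshev k (Z t)))) \<in> trig_polys m"
    by (intro trig_polys_mult[OF trig_polys_const[of _ 0], of _ m] trig_polys_add trig_polys_const) auto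
  then show ?thesis unfolding dirichlet_def by simp
qed

lemma dirichlet_bound:
  assumes "\<And>k. k \<le> m \<Longrightarrow> \<bar>chebyshev k z\<bar> \<le> b" "1 \<le> b"
  shows "\<bar>dirichlet m z\<bar> \<le> b"
proof -
  have "\<bar>1 + 2 * (\<Sum>k=1..m. chebyshev k z)\<bar> \<le> 1 + 2 * (\<Sum>k=1..m. \<bar>chebyshev k z\<bar>)"
    using sum_abs[of "\<lambda>k. chebyshev k z" "{1..m}"] by linarith
  also have "\<dots> \<le> b + 2 * (\<Sum>k=1..m. b)"
    using assms by (intro add_mono mult_left_mono sum_mono) auto
  finally show ?thesis unfolding dirichlet_def by (simp add: abs_mult field_simps)
qed

lemma dirichlet_le_1:
  assumes "\<bar>z\<bar> \<le> 1" shows "\<bar>dirichlet m z\<bar> \<le> 1"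
proof (rule dirichlet_bound)
  fix k
  have "z = cos (arccos z)" using assms by simp
  then show "\<bar>chebyshev k z\<bar> \<le> 1" by (metis chebyshev_cos abs_cos_le_one)
qed simp

lemma dirichlet_cos:
  "(2 * real m + 1) * dirichlet m (cos \<phi>) * sin (\<phi> / 2) = sin ((real m + 1/2) * \<phi>)"
proof -
  have "(1 + 2 * (\<Sum>k=1..m. cos (real k * \<phi>))) * sin (\<phi> / 2) = sin ((real m + 1/2) * \<phi>)"
  proof (induction m)
    case (Suc m)
    have "(real (Suc m) + 1/2) * \<phi> = real (Suc m) * \<phi> + \<phi>/2" "(real m + 1/2) * \<phi> = real (Suc m) * \<phi> - \<phi>/2"
      by (simp_all add: algebra_simps)
    then have "sin ((real (Suc m) + 1/2) * \<phi>) = sin ((real m + 1/2) * \<phi>) + 2 * cos (real (Suc m) * \<phi>) * sin (\<phi>/2)"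
      by (simp only: sin_add sin_diff)
    with Suc show ?case by (simp add: algebra_simps)
  qed simp
  then show ?thesis unfolding dirichlet_def chebyshev_cos by simp
qed

text \<open>With \<open>z = cos \<phi>\<close> the left-hand side is the square of \<open>sin ((m + 1/2) \<phi>)\<close>; so the kernel
  decays like \<open>1 / (m \<bar>\<phi>\<bar>)\<close> away from \<open>z = 1\<close>, which no Chebyshev polynomial does.\<close>

lemma dirichlet_decay:
  assumes "\<bar>z\<bar> \<le> 1"
  shows "((2 * real m + 1) * dirichlet m z)\<^sup>2 * ((1 - z) / 2) \<le> 1"
proof -
  define \<phi> where "\<phi> = arccos z"
  have z: "z = cos \<phi>" using assms by (simp add: \<phi>_def)
  have "cos \<phi> = 1 - 2 * (sin (\<phi>/2))\<^sup>2" using cos_double_sin[of "\<phi>/2"] by simp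
  then have "(1 - z) / 2 = (sin (\<phi>/2))\<^sup>2" unfolding z by simp
  then have "((2 * real m + 1) * dirichlet m z)\<^sup>2 * ((1 - z) / 2) = (sin ((real m + 1/2) * \<phi>))\<^sup>2"
    unfolding dirichlet_cos[symmetric] z by (simp add: power_mult_distrib)
  also have "\<dots> \<le> 1" by (simp add: abs_square_le_1)
  finally show ?thesis .
qed

lemma dirichlet_cosh_upper:
  assumes "0 \<le> \<theta>" shows "\<bar>dirichlet m (cosh \<theta>)\<bar> \<le> exp (real m * \<theta>)"
proof (rule dirichlet_bound)
  fix k assume "k \<le> m"
  then have le: "real k * \<theta> \<le> real m * \<theta>" using assms by (intro mult_right_mono) auto
  have "cosh (real k * \<theta>) \<le> exp (real k * \<theta>)"
    using assms unfolding cosh_plus_sinh[symmetric] by simp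
  also have "\<dots> \<le> exp (real m * \<theta>)" using le by simp
  finally show "\<bar>chebyshev k (cosh \<theta>)\<bar> \<le> exp (real m * \<theta>)" unfolding chebyshev_cosh by simp
qed (use assms in simp)

text \<open>Pairing the harmonics \<open>k\<close> and \<open>m - k\<close> and using the arithmetic-geometric mean inequality
  avoids the loss of a factor \<open>m\<close> that keeping only the top harmonic would cost.\<close>

lemma dirichlet_cosh_lower: "exp (real m * \<theta> / 2) / 2 \<le> dirichlet m (cosh \<theta>)"
proof -
  have "2 * exp (real m * \<theta> / 2) \<le> exp (real k * \<theta>) + exp (real (m - k) * \<theta>)" if "k \<le> m" for k
  proof -
    have e: "real m * \<theta> / 2 = real k * \<theta> / 2 + real (m - k) * \<theta> / 2"
      using that by (simp add: of_nat_diff field_simps)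
    have "0 \<le> (exp (real k * \<theta> / 2) - exp (real (m - k) * \<theta> / 2))\<^sup>2" by simp
    also have "\<dots> = exp (real k * \<theta>) + exp (real (m - k) * \<theta>) - 2 * exp (real m * \<theta> / 2)"
      unfolding e exp_add power2_diff by (simp add: exp_double[symmetric])
    finally show ?thesis by simp
  qed
  then have "(\<Sum>k\<le>m. 2 * exp (real m * \<theta> / 2)) \<le> (\<Sum>k\<le>m. exp (real k * \<theta>) + exp (real (m - k) * \<theta>))"
    by (intro sum_mono) auto
  also have "\<dots> = 2 * (\<Sum>k\<le>m. exp (real k * \<theta>))"
    using sum.nat_diff_reindex[of "\<lambda>k. exp (real k * \<theta>)" "Suc m"]
    by (simp add: sum.distrib lessThan_Suc_atMost)
  finally have "(real m + 1) * exp (real m * \<theta> / 2) \<le> (\<Sum>k\<le>m. exp (real k * \<theta>))"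
    by (simp add: algebra_simps)
  also have "\<dots> = 1 + (\<Sum>k=1..m. exp (real k * \<theta>))"
    unfolding atMost_atLeast0 by (subst sum.atLeast_Suc_atMost) auto
  also have "\<dots> \<le> 1 + (\<Sum>k=1..m. 2 * cosh (real k * \<theta>))"
    by (intro add_left_mono sum_mono) (simp add: cosh_def)
  also have "\<dots> = dirichlet m (cosh \<theta>) * (2 * real m + 1)"
    unfolding dirichlet_def chebyshev_cosh by (simp add: sum_distrib_left)
  finally have *: "(real m + 1) * exp (real m * \<theta> / 2) \<le> dirichlet m (cosh \<theta>) * (2 * real m + 1)" .
  have "(exp (real m * \<theta> / 2) / 2) * (2 * real m + 1) \<le> (real m + 1) * exp (real m * \<theta> / 2)"
    by (simp add: algebra_simps)
  also note *
  finally show ?thesis by simp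
qed

section \<open>Trigonometric polynomials with an exponential bump over a short arc\<close>

text \<open>An affine image of \<open>cos (x - s/2)\<close> that maps the arc outside \<open>[0, s]\<close> onto \<open>[-1, 1]\<close>,
  and so maps \<open>[0, s]\<close> to \<open>[1, \<infinity>)\<close>.\<close>

definition arc_map :: "real \<Rightarrow> real \<Rightarrow> real" where
  "arc_map s x = 2 * (1 + cos (x - s/2)) / (1 + cos (s/2)) - 1"

definition bump :: "real \<Rightarrow> nat \<Rightarrow> nat \<Rightarrow> real \<Rightarrow> real" where
  "bump s m j x = dirichlet m (arc_map s x) ^ (2 * j)"

lemma arc_map_trig_polys: "arc_map s \<in> trig_polys 1"
proof -
  define c where "c = 2 / (1 + cos (s/2))"
  have "(\<lambda>x. (c - 1) + (c * cos (s/2) * cos (real 1 * x) + c * sin (s/2) * sin (real 1 * x))) \<in> trig_polys 1"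
    by (intro trig_polys_add trig_polys_const trig_polys_monomial) simp
  moreover have "arc_map s x = (c - 1) + (c * cos (s/2) * cos (real 1 * x) + c * sin (s/2) * sin (real 1 * x))" for x
  proof -
    have "arc_map s x = c * (1 + cos (x - s/2)) - 1" by (simp add: arc_map_def c_def)
    then show ?thesis by (simp add: cos_diff algebra_simps)
  qed
  ultimately show ?thesis by presburger
qed

lemma bump_trig_polys: "bump s m j \<in> trig_polys (2 * j * m)"
  using trig_polys_power[OF dirichlet_trig_polys[OF arc_map_trig_polys]] unfolding bump_def by blast

lemma cos_ge_quadratic: "1 - x\<^sup>2 / 2 \<le> cos (x::real)"
proof -
  have "\<bar>sin (x/2)\<bar> \<le> \<bar>x/2\<bar>" by (rule abs_sin_x_le_abs_x)
  then have "(sin (x/2))\<^sup>2 \<le> (x/2)\<^sup>2" by (simp only: abs_le_square_iff)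
  then show ?thesis using cos_double_sin[of "x/2"] by (simp add: power2_eq_square)
qed

lemma cos_le_quadratic:
  assumes "\<bar>y\<bar> \<le> (2::real)" shows "cos y \<le> 1 - y\<^sup>2 / 3"
proof -
  obtain t where t: "cos y = (\<Sum>m<4. cos_coeff m * y ^ m) + (cos (t + 1/2 * real 4 * pi) / fact 4) * y ^ 4"
    using Maclaurin_cos_expansion[of y 4] by auto
  have "(\<Sum>m<4. cos_coeff m * y ^ m) = 1 - y\<^sup>2 / 2"
  proof -
    have "{..<4::nat} = {0, 1, 2, 3}" by auto
    then show ?thesis by (simp add: cos_coeff_def fact_numeral)
  qed
  moreover have "(cos (t + 1/2 * real 4 * pi) / fact 4) * y ^ 4 \<le> (1 / 24) * y ^ 4"
    by (intro mult_right_mono) (auto simp: fact_numeral intro!: divide_right_mono zero_le_even_power)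
  moreover have "y ^ 4 \<le> 4 * y\<^sup>2"
  proof -
    have "y\<^sup>2 \<le> 2\<^sup>2" using assms by (intro abs_le_square_iff[THEN iffD1]) simp
    then have "y\<^sup>2 * y\<^sup>2 \<le> 4 * y\<^sup>2" by (intro mult_right_mono) auto
    then show ?thesis by (simp add: eval_nat_numeral mult_ac)
  qed
  ultimately show ?thesis unfolding t by linarith
qed

lemma arc_map_alt:
  assumes "0 < s" "s \<le> 1/2"
  shows "arc_map s x - 1 = 2 * (cos (x - s/2) - cos (s/2)) / (1 + cos (s/2))" and "1/2 \<le> cos (s/2)"
proof -
  have "(s/2)\<^sup>2 \<le> 1\<^sup>2" using assms by (intro power_mono) auto
  then show *: "1/2 \<le> cos (s/2)" using cos_ge_quadratic[of "s/2"] by simp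
  then show "arc_map s x - 1 = 2 * (cos (x - s/2) - cos (s/2)) / (1 + cos (s/2))"
    unfolding arc_map_def by (simp add: field_simps)
qed

lemma cos_neg_of_beyond:
  assumes "2 \<le> \<bar>y\<bar>" "\<bar>y\<bar> \<le> pi + 1/2" shows "cos (y::real) \<le> 0"
proof (cases "\<bar>y\<bar> \<le> pi")
  case True
  then have "cos \<bar>y\<bar> \<le> cos 2" using assms by (intro cos_monotone_0_pi_le) auto
  with cos_two_le_zero show ?thesis unfolding cos_abs_real by linarith
next
  case False
  have "0 \<le> cos (\<bar>y\<bar> - pi)" using False assms pi_gt3 by (intro cos_ge_zero) auto
  then show ?thesis by (simp add: cos_diff)
qed

lemma arc_map_outside:
  assumes s: "0 < s" "s \<le> 1/2" and x: "-pi \<le> x" "x \<le> pi" "x \<notin> {0..s}"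
  shows "\<bar>arc_map s x\<bar> \<le> 1"
proof -
  note c = arc_map_alt[OF s]
  have "-1 \<le> arc_map s x" 
  proof -
    have "0 \<le> 1 + cos (x - s/2)" using cos_ge_minus_one[of "x - s/2"] by linarith
    then show ?thesis unfolding arc_map_def using c(2) by simp
  qed
  moreover have "cos (x - s/2) \<le> cos (s/2)"
  proof (cases "\<bar>x - s/2\<bar> \<le> 2")
    case True
    have "cos \<bar>x - s/2\<bar> \<le> cos (s/2)"
      using True x s pi_gt3 by (intro cos_monotone_0_pi_le) auto
    then show ?thesis by simp
  next
    case False
    then have "cos (x - s/2) \<le> 0" using x s by (intro cos_neg_of_beyond) auto
    then show ?thesis using c(2) by linarith
  qed
  then have "arc_map s x - 1 \<le> 0"
    unfolding c(1) using c(2) by (simp add: divide_nonpos_pos)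
  ultimately show ?thesis by linarith
qed

lemma bump_le_1:
  assumes "0 < s" "s \<le> 1/2" "-pi \<le> x" "x \<le> pi" "x \<notin> {0..s}"
  shows "\<bar>bump s m j x\<bar> \<le> 1"
  unfolding bump_def power_abs
  using dirichlet_le_1[OF arc_map_outside[OF assms]] by (intro power_le_one) auto

text \<open>At distance \<open>\<bar>y\<bar> \<ge> 2s\<close> from the centre of the arc \<open>1 - arc_map s x\<close> is of order \<open>y\<^sup>2\<close>, so the Dirichlet
  kernel is there at most of order \<open>1 / (m \<bar>y\<bar>)\<close>, which is at most \<open>s / \<bar>y\<bar>\<close> once \<open>m s\<close> exceeds
  an absolute constant.\<close>

lemma bump_decay:
  assumes s: "0 < s" "s \<le> 1/2" and x: "-pi \<le> x" "x \<le> pi" "2 * s \<le> \<bar>x - s/2\<bar>"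
    and m: "8 \<le> (2 * real m + 1) * s"
  shows "\<bar>bump s m j x\<bar> \<le> (s / \<bar>x - s/2\<bar>) ^ (2 * j)"
proof -
  define y where "y = x - s/2"
  have y: "2 * s \<le> \<bar>y\<bar>" "\<bar>y\<bar> \<le> pi + 1/2" "0 < \<bar>y\<bar>" using x s unfolding y_def by auto
  note c = arc_map_alt[OF s]
  have y2: "y\<^sup>2 / 32 \<ge> (s/2)\<^sup>2 / 2"
  proof -
    have "(2 * s)\<^sup>2 \<le> \<bar>y\<bar>\<^sup>2" using y s by (intro power_mono) auto
    then show ?thesis by (simp add: power2_eq_square)
  qed
  have "cos y \<le> 1 - y\<^sup>2 / 14"
  proof (cases "\<bar>y\<bar> \<le> 2")
    case True
    have "0 \<le> y\<^sup>2" by simp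
    then show ?thesis using cos_le_quadratic[OF True] by linarith
  next
    case False
    have "\<bar>y\<bar> ^ 2 \<le> (37/10) ^ 2" using y pi_less_4 pi_approx by (intro power_mono) auto
    then have "y\<^sup>2 / 14 \<le> 1" by (simp add: power2_eq_square)
    moreover have "cos y \<le> 0" using False y by (intro cos_neg_of_beyond) auto
    ultimately show ?thesis by linarith
  qed
  then have "cos (s/2) - cos y \<ge> y\<^sup>2 / 14 - y\<^sup>2 / 32"
    using cos_ge_quadratic[of "s/2"] y2 by linarith
  moreover have "y\<^sup>2 / 14 - y\<^sup>2 / 32 \<ge> y\<^sup>2 / 25" by simp
  ultimately have d: "cos (s/2) - cos y \<ge> y\<^sup>2 / 25" by linarith
  have "(1 - arc_map s x) / 2 = (cos (s/2) - cos y) / (1 + cos (s/2))"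
    using c(1)[of x] c(2) unfolding y_def by (simp add: field_simps)
  also have "\<dots> \<ge> (y\<^sup>2 / 25) / 2"
    using d c(2) zero_le_power2[of y] by (intro frac_le; linarith?) auto
  finally have z: "y\<^sup>2 / 50 \<le> (1 - arc_map s x) / 2" by simp
  have "((2 * real m + 1) * dirichlet m (arc_map s x))\<^sup>2 * (y\<^sup>2 / 50) \<le>
        ((2 * real m + 1) * dirichlet m (arc_map s x))\<^sup>2 * ((1 - arc_map s x) / 2)"
    using z by (intro mult_left_mono) auto
  also have "\<dots> \<le> 1"
    using x s by (intro dirichlet_decay arc_map_outside[OF s]) auto
  finally have D: "((2 * real m + 1) * dirichlet m (arc_map s x) * y)\<^sup>2 \<le> 50"
    by (simp add: power_mult_distrib)
  have "(8 * (dirichlet m (arc_map s x) * y))\<^sup>2 \<le> ((2 * real m + 1) * s * (dirichlet m (arc_map s x) * y))\<^sup>2"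
    using m by (intro abs_le_square_iff[THEN iffD1]) (use s in \<open>simp add: abs_mult mult_right_mono\<close>)
  also have "\<dots> = s\<^sup>2 * ((2 * real m + 1) * dirichlet m (arc_map s x) * y)\<^sup>2"
    by (simp add: power_mult_distrib)
  also have "\<dots> \<le> s\<^sup>2 * 50" using D by (intro mult_left_mono) auto
  also have "\<dots> \<le> (8 * s)\<^sup>2" by (simp add: power_mult_distrib)
  finally have "\<bar>8 * (dirichlet m (arc_map s x) * y)\<bar> \<le> \<bar>8 * s\<bar>"
    by (simp only: abs_le_square_iff)
  then have "\<bar>dirichlet m (arc_map s x)\<bar> \<le> s / \<bar>y\<bar>"
    using s y by (simp add: abs_mult field_simps)
  then show ?thesis unfolding bump_def power_abs y_def[symmetric] by (intro power_mono) auto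
qed

lemma arc_map_inside:
  assumes s: "0 < s" "s \<le> 1/2" and x: "x \<in> {0..s}"
  shows "1 \<le> arc_map s x" "arc_map s x \<le> cosh s"
proof -
  note c = arc_map_alt[OF s]
  have "cos (s/2) \<le> cos \<bar>x - s/2\<bar>"
    using x s pi_gt3 by (intro cos_monotone_0_pi_le) (auto simp: abs_if)
  then have "0 \<le> arc_map s x - 1" unfolding c(1) using c(2) by simp
  then show "1 \<le> arc_map s x" by simp
  have s2: "s\<^sup>2 \<le> 1" using s by (simp add: abs_square_le_1)
  have "arc_map s x - 1 \<le> 2 * (1 - cos (s/2)) / (1 + cos (s/2))"
    unfolding c(1) using c(2) by (intro divide_right_mono) auto
  also have "\<dots> \<le> 2 * (s\<^sup>2 / 8) / (1 + 0)"
    using c(2) cos_ge_quadratic[of "s/2"] by (intro frac_le) (auto simp: power2_eq_square)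
  also have "\<dots> \<le> cosh s - 1"
  proof -
    have "1 + s + s\<^sup>2/2 \<le> exp s" "1 + (-s) + (-s)\<^sup>2/2 \<le> exp (-s) + s\<^sup>2/2"
      using s exp_lower_Taylor_quadratic[of s] exp_ge_add_one_self[of "-s"] by auto
    moreover have "cosh s = (exp s + exp (-s)) / 2" by (simp add: cosh_field_def)
    ultimately show ?thesis by (simp add: field_simps)
  qed
  finally show "arc_map s x \<le> cosh s" by simp
qed

text \<open>On the arc \<open>arc_map s x = cosh \<theta>\<close> with \<open>\<theta> \<le> s\<close>.\<close>

lemma bump_le_exp:
  assumes s: "0 < s" "s \<le> 1/2" and x: "x \<in> {0..s}"
  shows "\<bar>bump s m j x\<bar> \<le> exp (real (2 * j * m) * s)"
proof -
  define \<theta> where "\<theta> = arcosh (arc_map s x)"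
  have \<theta>: "cosh \<theta> = arc_map s x" "0 \<le> \<theta>" unfolding \<theta>_def using arc_map_inside[OF assms] by auto
  have "\<theta> \<le> s" using arc_map_inside(2)[OF assms] s \<theta> cosh_real_nonneg_le_iff[of \<theta> s] by simp
  then have "exp (real m * \<theta>) \<le> exp (real m * s)" by (simp add: mult_left_mono)
  with dirichlet_cosh_upper[OF \<theta>(2), of m] have "\<bar>dirichlet m (arc_map s x)\<bar> \<le> exp (real m * s)"
    unfolding \<theta>(1) by linarith
  then have "\<bar>dirichlet m (arc_map s x)\<bar> ^ (2 * j) \<le> exp (real m * s) ^ (2 * j)" by (intro power_mono) auto
  then show ?thesis unfolding bump_def power_abs exp_of_nat_mult[symmetric] by (simp add: mult_ac)
qed

text \<open>The decisive feature of the bump: at relative depth \<open>\<sigma>\<^sup>2\<close> below the end of the arc its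
  exponent is already of order \<open>\<sigma>\<close>. Indeed \<open>arc_map s x - 1\<close> is there of order \<open>(\<sigma> s)\<^sup>2\<close>, so that
  \<open>arc_map s x = cosh \<theta>\<close> with \<open>\<theta>\<close> of order \<open>\<sigma> s\<close>.\<close>

lemma bump_lower:
  assumes s: "0 < s" "s \<le> 1/2" and \<sigma>: "0 < \<sigma>" "\<sigma> \<le> 1/2"
    and x: "s - 2 * \<sigma>\<^sup>2 * s \<le> x" "x \<le> s - \<sigma>\<^sup>2 * s"
  shows "(1/4) ^ j * exp (real (2 * j * m) * (\<sigma> * s / 8)) \<le> bump s m j x"
proof -
  define y where "y = x - s/2"
  note c = arc_map_alt[OF s]
  have \<sigma>2: "\<sigma>\<^sup>2 \<le> (1/2)\<^sup>2" "0 < \<sigma>\<^sup>2" using \<sigma> power_mono[of \<sigma> "1/2" 2] by auto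
  have \<sigma>s: "4 * (\<sigma>\<^sup>2 * s) \<le> s" "0 < \<sigma>\<^sup>2 * s"
    using \<sigma>2 s mult_right_mono[of "\<sigma>\<^sup>2" "1/4" s] by (auto simp: power2_eq_square)
  then have x0: "x \<in> {0..s}" using x s unfolding mult.assoc atLeastAtMost_iff by linarith
  have y0: "0 \<le> y" "y \<le> s/2 - \<sigma>\<^sup>2 * s" unfolding y_def using x \<sigma>s unfolding mult.assoc by linarith+
  have sin_ge: "u / 2 \<le> sin u" if "0 \<le> u" "u \<le> 1" for u :: real
  proof -
    have "(\<lambda>v. sin v - v / 2) 0 \<le> (\<lambda>v. sin v - v / 2) u"
    proof (rule DERIV_nonneg_imp_nondecreasing[OF that(1)])
      fix v assume v: "0 \<le> v" "v \<le> u"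
      have "v\<^sup>2 \<le> 1" using v that by (simp add: power_le_one)
      then have "0 \<le> cos v - 1/2" using cos_ge_quadratic[of v] by linarith
      then show "\<exists>d. ((\<lambda>v. sin v - v / 2) has_real_derivative d) (at v) \<and> 0 \<le> d"
        by (intro exI[of _ "cos v - 1/2"]) (auto intro!: derivative_eq_intros)
    qed
    then show ?thesis by simp
  qed
  have "((y + s/2) / 2 / 2) * ((s/2 - y) / 2 / 2) \<le> sin ((y + s/2) / 2) * sin ((s/2 - y) / 2)"
    using y0 s \<sigma>s by (intro mult_mono sin_ge sin_ge_zero) (use pi_gt3 in auto)
  then have "2 * ((y + s/2) / 2 / 2) * ((s/2 - y) / 2 / 2) \<le> cos y - cos (s/2)"
    unfolding cos_diff_cos by (simp add: field_simps)
  moreover have "(\<sigma> * s / 4)\<^sup>2 \<le> 2 * ((y + s/2) / 2 / 2) * ((s/2 - y) / 2 / 2)"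
  proof -
    have "(s/2) * (\<sigma>\<^sup>2 * s) \<le> (y + s/2) * (s/2 - y)"
      using y0 s \<sigma>s by (intro mult_mono) auto
    then show ?thesis by (simp add: power2_eq_square field_simps)
  qed
  moreover have "cos y - cos (s/2) \<le> arc_map s x - 1"
  proof -
    have "0 \<le> cos y - cos (s/2)" using calculation by (meson order.trans zero_le_power2)
    then have "(cos y - cos (s/2)) * (1 + cos (s/2)) \<le> (cos y - cos (s/2)) * 2"
      by (intro mult_left_mono) auto
    then show ?thesis unfolding c(1) y_def using c(2) by (simp add: pos_le_divide_eq)
  qed
  ultimately have z: "1 + (\<sigma> * s / 4)\<^sup>2 \<le> arc_map s x" by linarith
  define \<theta> where "\<theta> = arcosh (arc_map s x)"
  have \<theta>: "cosh \<theta> = arc_map s x" "0 \<le> \<theta>" unfolding \<theta>_def using arc_map_inside[OF s x0] by auto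
  have "cosh (\<sigma> * s / 4) \<le> 1 + (\<sigma> * s / 4)\<^sup>2"
  proof -
    define u where "u = \<sigma> * s / 4"
    have u: "0 \<le> u" "u \<le> 1" using \<sigma> s mult_mono[of \<sigma> "1/2" s "1/2"] by (auto simp: u_def)
    have "exp u \<le> 1 + u + u\<^sup>2" "exp (-u) \<le> 1 - u + u\<^sup>2" 
    proof -
      show "exp u \<le> 1 + u + u\<^sup>2" using u exp_bound[of u] by simp
      have "1 \<le> (1 - u + u\<^sup>2) * (1 + u)" using u by (simp add: algebra_simps power2_eq_square)
      also have "\<dots> \<le> (1 - u + u\<^sup>2) * exp u"
        using u exp_ge_add_one_self[of u] by (intro mult_left_mono) auto
      finally show "exp (-u) \<le> 1 - u + u\<^sup>2" by (simp add: exp_minus field_simps)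
    qed
    then show ?thesis unfolding u_def[symmetric] cosh_field_def by simp
  qed
  then have "\<sigma> * s / 4 \<le> \<theta>"
    using z \<theta> \<sigma> s cosh_real_nonneg_le_iff[of "\<sigma> * s / 4" \<theta>] by simp
  then have "real m * (\<sigma> * s / 4) \<le> real m * \<theta>" by (intro mult_left_mono) auto
  then have "exp (real m * (\<sigma> * s / 8)) \<le> exp (real m * \<theta> / 2)"
    by (simp add: field_simps)
  with dirichlet_cosh_lower[of m \<theta>] have "exp (real m * (\<sigma> * s / 8)) / 2 \<le> dirichlet m (arc_map s x)"
    unfolding \<theta>(1) by linarith
  then have "(exp (real m * (\<sigma> * s / 8)) / 2) ^ (2 * j) \<le> bump s m j x"
    unfolding bump_def by (intro power_mono) auto
  moreover have "(exp (real m * (\<sigma> * s / 8)) / 2) ^ (2 * j) = (1/4) ^ j * exp (real (2 * j * m) * (\<sigma> * s / 8))"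
  proof -
    have "exp (real (2 * j * m) * (\<sigma> * s / 8)) = exp (real m * (\<sigma> * s / 8)) ^ (2 * j)"
      by (simp add: exp_of_nat_mult[symmetric] mult_ac)
    moreover have "(2::real) ^ (2 * j) = 4 ^ j" by (simp add: power_mult)
    ultimately show ?thesis by (simp add: power_divide)
  qed
  ultimately show ?thesis by simp
qed

section \<open>The weighted quasi-norm of a continuous function\<close>

lemma space_circle_measure: "space circle_measure = {-pi..pi}"
  by (simp add: circle_measure_def space_restrict_space)

lemma measurable_circle_measure:
  fixes f :: "real \<Rightarrow> 'a::topological_space"
  assumes "f \<in> borel_measurable borel" shows "f \<in> borel_measurable circle_measure"
  unfolding circle_measure_def by (rule measurable_restrict_space1) (use assms in simp)

lemma integrable_circle_measure:
  fixes f :: "real \<Rightarrow> real"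
  assumes "continuous_on UNIV f" shows "integrable circle_measure f"
proof -
  have "set_integrable lborel {-pi..pi} f"
    by (rule borel_integrable_atLeastAtMost') (rule continuous_on_subset[OF assms subset_UNIV])
  then show ?thesis
    unfolding circle_measure_def set_integrable_def by (subst integrable_restrict_space) auto
qed

lemma emeasure_circle_interval:
  assumes "-pi \<le> a" "a + d \<le> pi" "0 \<le> d"
  shows "emeasure circle_measure {a..a+d} = ennreal d"
  unfolding circle_measure_def using assms by (subst emeasure_restrict_space) auto

lemma sets_circle_interval:
  assumes "-pi \<le> a" "b \<le> pi"
  shows "{a..b} \<in> sets circle_measure"
  unfolding circle_measure_def using assms by (subst sets_restrict_space_iff) auto

lemma AE_circle_interval:
  assumes "AE x in circle_measure. P x" "-pi \<le> a" "a + d \<le> pi" "0 < d"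
  shows "\<exists>x\<in>{a..a+d}. P x"
proof (rule ccontr)
  assume neg: "\<not> ?thesis"
  obtain N where N: "{x \<in> space circle_measure. \<not> P x} \<subseteq> N" "N \<in> null_sets circle_measure"
    using assms(1) by (auto simp: eventually_ae_filter)
  have "{a..a+d} \<subseteq> N" using neg N(1) assms by (auto simp: space_circle_measure)
  then have "{a..a+d} \<in> null_sets circle_measure"
    using N(2) assms by (meson null_sets_subset sets_circle_interval)
  then show False using emeasure_circle_interval[of a d] assms by (auto simp: null_sets_def)
qed

lemma integral_circle_interval:
  assumes "-pi \<le> a" "a + d \<le> pi" "0 \<le> d"
  shows "integrable circle_measure (\<lambda>x. indicator {a..a+d} x * c :: real)"
    and "(\<integral>x. indicator {a..a+d} x * c \<partial>circle_measure) = d * (c::real)"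
proof -
  note e = emeasure_circle_interval[OF assms]
  have i: "has_bochner_integral circle_measure (\<lambda>x. indicator {a..a+d} x :: real) d"
    using has_bochner_integral_real_indicator[OF sets_circle_interval[of a "a+d"]] e assms
    by (simp add: measure_def)
  show "integrable circle_measure (\<lambda>x. indicator {a..a+d} x * c :: real)"
    and "(\<integral>x. indicator {a..a+d} x * c \<partial>circle_measure) = d * c"
    using i by (auto simp: has_bochner_integral_iff)
qed

lemma integral_circle_cauchy_kernel:
  assumes "0 < s"
  shows "(\<integral>x. s\<^sup>2 / (s\<^sup>2 + (x - c)\<^sup>2) \<partial>circle_measure) \<le> pi * s"
proof -
  have pos: "0 < s\<^sup>2 + (x - c)\<^sup>2" for x using assms by (intro add_pos_nonneg) auto
  have "(\<integral>x. s\<^sup>2 / (s\<^sup>2 + (x - c)\<^sup>2) \<partial>circle_measure) =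
     (\<integral>x. indicator {-pi..pi} x *\<^sub>R (s\<^sup>2 / (s\<^sup>2 + (x - c)\<^sup>2)) \<partial>lborel)"
    unfolding circle_measure_def by (subst integral_restrict_space) auto
  also have "\<dots> = s * arctan ((pi - c) / s) - s * arctan ((-pi - c) / s)"
  proof (rule integral_FTC_atLeastAtMost)
    fix x
    have "((\<lambda>x. s * arctan ((x - c) / s)) has_real_derivative s * (inverse (1 + ((x - c) / s)\<^sup>2) * (1 / s))) (at x)"
      using assms by (auto intro!: derivative_eq_intros)
    moreover have "s * (inverse (1 + ((x - c) / s)\<^sup>2) * (1 / s)) = s\<^sup>2 / (s\<^sup>2 + (x - c)\<^sup>2)"
    proof -
      have "1 + ((x - c) / s)\<^sup>2 = (s\<^sup>2 + (x - c)\<^sup>2) / s\<^sup>2"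
        using assms by (simp add: power_divide add_divide_distrib)
      then show ?thesis using assms by simp
    qed
    ultimately show "((\<lambda>x. s * arctan ((x - c) / s)) has_vector_derivative s\<^sup>2 / (s\<^sup>2 + (x - c)\<^sup>2)) (at x within {-pi..pi})"
      by (simp add: has_real_derivative_iff_has_vector_derivative[symmetric] has_field_derivative_at_within)
  qed (use pos in \<open>auto intro!: continuous_intros simp: less_imp_neq[symmetric]\<close>)
  also have "\<dots> \<le> s * (pi/2) - s * (- (pi/2))"
    using assms arctan_bounded[of "(pi - c) / s"] arctan_bounded[of "(-pi - c) / s"]
    by (intro diff_mono mult_left_mono) auto
  finally show ?thesis by (simp add: mult.commute)
qed

lemma Lp_norm_finite:
  assumes "0 < q"
  shows "Lp_norm (ennreal q) \<omega> f = (\<integral>t. \<bar>f t\<bar> powr q * \<omega> t \<partial>circle_measure) powr (1 / q)"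
  using assms by (simp add: Lp_norm_def)

lemma integrable_powr_weight:
  assumes "0 < q" "continuous_on UNIV f" "continuous_on UNIV \<omega>"
  shows "integrable circle_measure (\<lambda>t. \<bar>f t\<bar> powr q * (\<omega> t :: real))"
  by (intro integrable_circle_measure continuous_intros assms continuous_on_powr') (use assms in auto)

lemma Lp_norm_infinity:
  assumes cont: "continuous_on UNIV f" "continuous_on UNIV \<omega>"
  shows "AE x in circle_measure. \<bar>f x * \<omega> x\<bar> \<le> Lp_norm \<infinity> \<omega> f" (is ?A)
    and "0 \<le> Lp_norm \<infinity> \<omega> f"
    and "(AE x in circle_measure. \<bar>f x * \<omega> x\<bar> \<le> E) \<Longrightarrow> Lp_norm \<infinity> \<omega> f \<le> E"
proof -
  define g where "g = (\<lambda>t. ereal \<bar>f t * \<omega> t\<bar>)"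
  have cg: "continuous_on UNIV (\<lambda>t. \<bar>f t * \<omega> t\<bar>)" by (intro continuous_intros cont)
  have meas: "g \<in> borel_measurable circle_measure"
    unfolding g_def by (intro measurable_circle_measure borel_measurable_ereal borel_measurable_continuous_onI cg)
  have "\<exists>x\<in>{-pi..pi}. \<forall>y\<in>{-pi..pi}. \<bar>f y * \<omega> y\<bar> \<le> \<bar>f x * \<omega> x\<bar>"
    using pi_gt3 by (intro continuous_attains_sup continuous_on_subset[OF cg]) auto
  then obtain W where W: "\<And>x. x \<in> {-pi..pi} \<Longrightarrow> \<bar>f x * \<omega> x\<bar> \<le> W" by blast
  have up: "esssup circle_measure g \<le> ereal E" if "AE x in circle_measure. \<bar>f x * \<omega> x\<bar> \<le> E" for E
    by (rule esssup_I[OF meas]) (use that in \<open>simp add: g_def\<close>)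
  have "AE x in circle_measure. \<bar>f x * \<omega> x\<bar> \<le> W"
    using W by (intro AE_I2) (simp add: space_circle_measure)
  note upW = up[OF this]
  have AE: "AE x in circle_measure. g x \<le> esssup circle_measure g" by (rule esssup_AE)
  obtain x where "g x \<le> esssup circle_measure g"
    using AE_circle_interval[OF AE, of 0 1] pi_gt3 by auto
  then have lo: "0 \<le> esssup circle_measure g" unfolding g_def by (meson order.trans abs_ge_zero ereal_less_eq(5))
  obtain v where v: "esssup circle_measure g = ereal v"
    using upW lo by (cases "esssup circle_measure g") auto
  have n: "Lp_norm \<infinity> \<omega> f = v" unfolding Lp_norm_def using v by (simp add: g_def)
  show ?A using AE[unfolded v] unfolding n by (simp add: g_def)
  show "0 \<le> Lp_norm \<infinity> \<omega> f" using lo unfolding v n by simp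
  show "(AE x in circle_measure. \<bar>f x * \<omega> x\<bar> \<le> E) \<Longrightarrow> Lp_norm \<infinity> \<omega> f \<le> E" 
    using up unfolding v n by simp
qed

lemma Lp_norm_zero_AE:
  assumes cont: "continuous_on UNIV f" "continuous_on UNIV \<omega>" and nn: "\<And>t. 0 \<le> \<omega> t" and "0 < p"
    and z: "Lp_norm p \<omega> f = 0"
  shows "AE x in circle_measure. f x * \<omega> x = 0"
proof (cases p)
  case (real q)
  with \<open>0 < p\<close> have q: "0 < q" by simp
  have "(\<integral>t. \<bar>f t\<bar> powr q * \<omega> t \<partial>circle_measure) = 0"
    using z unfolding real Lp_norm_finite[OF q] by simp
  then have "AE x in circle_measure. \<bar>f x\<bar> powr q * \<omega> x = 0"
    by (subst (asm) integral_nonneg_eq_0_iff_AE) (auto intro: integrable_powr_weight[OF q cont] simp: nn)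
  then show ?thesis by (rule eventually_mono) auto
next
  case top
  have "AE x in circle_measure. \<bar>f x * \<omega> x\<bar> \<le> 0"
    using Lp_norm_infinity(1)[OF cont] z unfolding top by (simp add: top_ennreal_def)
  then show ?thesis by (rule eventually_mono) auto
qed

lemma Lp_norm_cong_AE:
  assumes cont: "continuous_on UNIV f" "continuous_on UNIV g" "continuous_on UNIV \<omega>"
    and AE: "AE x in circle_measure. f x = g x \<or> \<omega> x = 0"
  shows "Lp_norm p \<omega> f = Lp_norm p \<omega> g"
proof -
  have [measurable]: "f \<in> borel_measurable borel" "g \<in> borel_measurable borel" "\<omega> \<in> borel_measurable borel"
    using cont by (auto intro: borel_measurable_continuous_onI)
  have "(\<integral>t. \<bar>f t\<bar> powr enn2real p * \<omega> t \<partial>circle_measure) =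
        (\<integral>t. \<bar>g t\<bar> powr enn2real p * \<omega> t \<partial>circle_measure)"
  proof (rule integral_cong_AE)
    show "AE t in circle_measure. \<bar>f t\<bar> powr enn2real p * \<omega> t = \<bar>g t\<bar> powr enn2real p * \<omega> t"
      by (rule eventually_mono[OF AE]) auto
  qed (rule measurable_circle_measure, measurable)+
  moreover have "esssup circle_measure (\<lambda>t. ereal \<bar>f t * \<omega> t\<bar>) = esssup circle_measure (\<lambda>t. ereal \<bar>g t * \<omega> t\<bar>)"
    by (intro esssup_AE_cong measurable_circle_measure borel_measurable_ereal borel_measurable_continuous_onI
          continuous_intros cont eventually_mono[OF AE]) auto
  ultimately show ?thesis unfolding Lp_norm_def by simp
qed

lemma Lp_norm_const:
  assumes "0 < p" "0 < c"
  shows "Lp_norm p \<omega> (\<lambda>t. c) = c * Lp_norm p \<omega> (\<lambda>t. 1)"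
proof (cases p)
  case (real q)
  with \<open>0 < p\<close> have q: "0 < q" by simp
  have "(c powr q * (\<integral>t. \<omega> t \<partial>circle_measure)) powr (1/q) = c * (\<integral>t. \<omega> t \<partial>circle_measure) powr (1/q)"
    using q assms by (cases "(\<integral>t. \<omega> t \<partial>circle_measure) \<ge> 0") (simp_all add: powr_mult powr_powr)
  then show ?thesis unfolding real Lp_norm_finite[OF q] using assms by simp
next
  case top
  have "esssup circle_measure (\<lambda>t. ereal \<bar>c * \<omega> t\<bar>) = ereal c * esssup circle_measure (\<lambda>t. ereal \<bar>\<omega> t\<bar>)"
    using esssup_cmult[OF assms(2), of circle_measure "\<lambda>t. ereal \<bar>\<omega> t\<bar>"] assms by (simp add: abs_mult)
  then show ?thesis unfolding top Lp_norm_def by (simp add: top_ennreal_def)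
qed

lemma Lp_norm_nonneg:
  assumes "continuous_on UNIV f" "continuous_on UNIV \<omega>"
  shows "0 \<le> Lp_norm p \<omega> f"
  using Lp_norm_infinity(2)[OF assms] by (cases "p = \<infinity>") (auto simp: Lp_norm_def)

text \<open>A Bernstein inequality for the functions of positive norm extends to those of norm zero: if
  \<open>\<parallel>Q\<parallel> = 0\<close> then \<open>\<parallel>Q + \<delta>\<parallel> = \<delta> \<parallel>1\<parallel>\<close> is positive and arbitrarily small, while \<open>Q + \<delta>\<close> has
  the same derivative as \<open>Q\<close>.\<close>

lemma bernstein_norm_zero:
  assumes cont: "continuous_on UNIV \<omega>" and nn: "\<And>t. 0 \<le> \<omega> t" and "0 < p"
    and pos: "0 < d" "d \<le> pi" "\<And>t. t \<in> {0<..<d} \<Longrightarrow> 0 < \<omega> t"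
    and "0 \<le> C"
    and B: "\<And>Q. Q \<in> trig_polys K \<Longrightarrow> 0 < Lp_norm p \<omega> Q \<Longrightarrow> Lp_norm p \<omega> (deriv Q) \<le> C * Lp_norm p \<omega> Q"
    and Q: "Q \<in> trig_polys K"
  shows "Lp_norm p \<omega> (deriv Q) \<le> C * Lp_norm p \<omega> Q"
proof (cases "Lp_norm p \<omega> Q = 0")
  case False
  then have "0 < Lp_norm p \<omega> Q"
    using Lp_norm_nonneg[OF trig_polys_continuous[OF Q] cont, of p] by linarith
  then show ?thesis by (rule B[OF Q])
next
  case True
  note cQ = trig_polys_continuous[OF Q, of UNIV]
  have "Lp_norm p \<omega> (\<lambda>t. 1) \<noteq> 0"
  proof
    assume "Lp_norm p \<omega> (\<lambda>t. 1) = 0"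
    then have z: "AE x in circle_measure. (1::real) * \<omega> x = 0"
      using Lp_norm_zero_AE[of "\<lambda>_. 1" \<omega> p] cont nn \<open>0 < p\<close> by simp
    obtain x where "x \<in> {d/3..d/3+d/3}" "1 * \<omega> x = 0"
      using AE_circle_interval[OF z, of "d/3" "d/3"] pos pi_gt3 by auto
    moreover have "0 < \<omega> x" using calculation(1) pos by (intro pos(3)) auto
    ultimately show False by simp
  qed
  then have one: "0 < Lp_norm p \<omega> (\<lambda>t. 1)"
    using Lp_norm_nonneg[of "\<lambda>_. 1" \<omega> p] cont by simp
  have le: "Lp_norm p \<omega> (deriv Q) \<le> C * Lp_norm p \<omega> (\<lambda>t. 1) * \<delta>" if "0 < \<delta>" for \<delta>
  proof -
    have "Lp_norm p \<omega> (\<lambda>t. Q t + \<delta>) = Lp_norm p \<omega> (\<lambda>t. \<delta>)"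
      by (intro Lp_norm_cong_AE continuous_intros cQ cont
            eventually_mono[OF Lp_norm_zero_AE[OF cQ cont nn \<open>0 < p\<close> True]]) auto
    then have n: "Lp_norm p \<omega> (\<lambda>t. Q t + \<delta>) = \<delta> * Lp_norm p \<omega> (\<lambda>t. 1)"
      using Lp_norm_const[OF \<open>0 < p\<close> that] by simp
    have "deriv (\<lambda>t. Q t + \<delta>) = deriv Q"
    proof
      fix x
      have "((\<lambda>t. Q t + \<delta>) has_real_derivative deriv Q x + 0) (at x)"
        by (intro derivative_intros trig_polys_differentiable[OF Q])
      then show "deriv (\<lambda>t. Q t + \<delta>) x = deriv Q x" by (simp add: DERIV_imp_deriv)
    qed
    then show ?thesis
      using B[OF trig_polys_add[OF Q trig_polys_const[of \<delta>]]] n that one by (simp add: mult_ac)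
  qed
  have "Lp_norm p \<omega> (deriv Q) \<le> 0"
  proof (rule field_le_epsilon)
    fix \<epsilon> :: real assume "0 < \<epsilon>"
    define M where "M = C * Lp_norm p \<omega> (\<lambda>t. 1)"
    have M: "0 \<le> M" using \<open>0 \<le> C\<close> one by (simp add: M_def)
    have "Lp_norm p \<omega> (deriv Q) \<le> M * (\<epsilon> / (M + 1))"
      unfolding M_def[symmetric] using le[of "\<epsilon> / (M + 1)"] M \<open>0 < \<epsilon>\<close> by (simp add: M_def)
    also have "\<dots> \<le> \<epsilon>" using M \<open>0 < \<epsilon>\<close> by (simp add: field_simps)
    finally show "Lp_norm p \<omega> (deriv Q) \<le> 0 + \<epsilon>" by simp
  qed
  then show ?thesis using True by simp
qed

section \<open>Translating a polynomial under a Bernstein inequality\<close>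

text \<open>The form in which a Bernstein inequality is used, common to all exponents \<open>p\<close> (with \<open>q = p\<close>,
  and \<open>q = 1\<close> if \<open>p = \<infinity>\<close>): moving \<open>Q\<close> by \<open>h\<close> under the weight costs at most a factor
  \<open>exp (O(K \<bar>h\<bar>))\<close>. The size of \<open>Q\<close> is measured against a Cauchy kernel of width \<open>s\<close>, whose
  integral is of order \<open>s\<close>, so that both sides scale alike when \<open>d\<close> is comparable to \<open>s\<close>.\<close>

definition translation_estimate :: "(real \<Rightarrow> real) \<Rightarrow> real \<Rightarrow> real \<Rightarrow> nat \<Rightarrow> real \<Rightarrow> bool" where
  "translation_estimate \<omega> q C K\<^sub>0 B \<longleftrightarrow>
    (\<forall>K \<ge> K\<^sub>0. \<forall>Q \<in> trig_polys K. \<forall>a d h s c e L E.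
       0 < d \<longrightarrow> d \<le> s \<longrightarrow> -pi \<le> a \<longrightarrow> a + d \<le> pi \<longrightarrow> 0 \<le> e \<longrightarrow> 0 < L \<longrightarrow> 0 \<le> E \<longrightarrow>
       (\<forall>x\<in>{a..a+d}. e \<le> \<omega> x \<and> L \<le> \<bar>Q (x + h)\<bar>) \<longrightarrow>
       (\<forall>x\<in>{-pi..pi}. \<bar>Q x\<bar> powr q * \<omega> x \<le> E * (s\<^sup>2 / (s\<^sup>2 + (x - c)\<^sup>2))) \<longrightarrow>
       d * e * L powr q \<le> B * exp (4 * C * K * \<bar>h\<bar> * q) * E * s)"

lemma translation_estimateD:
  assumes "translation_estimate \<omega> q C K\<^sub>0 B" "K\<^sub>0 \<le> K" "Q \<in> trig_polys K"
    "0 < d" "d \<le> s" "-pi \<le> a" "a + d \<le> pi" "0 \<le> e" "0 < L" "0 \<le> E"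
    "\<And>x. x \<in> {a..a+d} \<Longrightarrow> e \<le> \<omega> x" "\<And>x. x \<in> {a..a+d} \<Longrightarrow> L \<le> \<bar>Q (x + h)\<bar>"
    "\<And>x. x \<in> {-pi..pi} \<Longrightarrow> \<bar>Q x\<bar> powr q * \<omega> x \<le> E * (s\<^sup>2 / (s\<^sup>2 + (x - c)\<^sup>2))"
  shows "d * e * L powr q \<le> B * exp (4 * C * K * \<bar>h\<bar> * q) * E * s"
  by (rule assms(1)[unfolded translation_estimate_def, rule_format, OF assms(2-10)])
     (use assms(11-13) in auto)

text \<open>The hypothesis may be due to the behaviour of the weight on the left of \<open>0\<close>; reflecting the
  translation estimate reduces that case to the other one.\<close>

lemma translation_estimate_reflect:
  assumes T: "translation_estimate \<omega> q C K\<^sub>0 B"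
  shows "translation_estimate (\<lambda>x. \<omega> (- x)) q C K\<^sub>0 B"
  unfolding translation_estimate_def
proof (intro allI ballI impI)
  fix K Q and a d h s c e L E :: real
  assume K: "K\<^sub>0 \<le> K" and Q: "Q \<in> trig_polys K"
    and pos: "0 < d" "d \<le> s" "- pi \<le> a" "a + d \<le> pi" "0 \<le> e" "0 < L" "0 \<le> E"
    and G: "\<forall>x\<in>{a..a+d}. e \<le> \<omega> (- x) \<and> L \<le> \<bar>Q (x + h)\<bar>"
    and U: "\<forall>x\<in>{-pi..pi}. \<bar>Q x\<bar> powr q * \<omega> (- x) \<le> E * (s\<^sup>2 / (s\<^sup>2 + (x - c)\<^sup>2))"
  have "d * e * L powr q \<le> B * exp (4 * C * K * \<bar>- h\<bar> * q) * E * s"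
  proof (rule translation_estimateD[OF T K trig_polys_reflect[OF Q], where a = "- (a + d)" and c = "- c"])
    fix x
    show "e \<le> \<omega> x" if "x \<in> {- (a + d)..- (a + d) + d}"
      using that G[rule_format, of "- x"] by auto
    show "L \<le> \<bar>Q (- (x + - h))\<bar>" if "x \<in> {- (a + d)..- (a + d) + d}"
      using that G[rule_format, of "- x"] by (auto simp: algebra_simps)
    show "\<bar>Q (- x)\<bar> powr q * \<omega> x \<le> E * (s\<^sup>2 / (s\<^sup>2 + (x - - c)\<^sup>2))" if "x \<in> {-pi..pi}"
      using that U[rule_format, of "- x"] power2_commute[of "- x" c] by (simp add: add.commute)
  qed (use pos in auto)
  then show "d * e * L powr q \<le> B * exp (4 * C * K * \<bar>h\<bar> * q) * E * s" by simp
qed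

text \<open>A substitute for the triangle inequality that also serves exponents \<open>q < 1\<close>: one of the
  terms \<open>u k\<close> is at least the share \<open>2\<^sup>-\<^sup>k\<^sup>-\<^sup>1\<close> of the total.\<close>

lemma powr_le_sum_powr:
  fixes u :: "nat \<Rightarrow> real"
  assumes "0 < y" "y \<le> (\<Sum>k<n. u k)" "0 < q"
  shows "y powr q \<le> (\<Sum>k<n. (2 ^ Suc k * \<bar>u k\<bar>) powr q)"
proof -
  have geo: "(\<Sum>k<n. (1/2::real) ^ Suc k) < 1"
  proof -
    have "(\<Sum>k<n. (1/2::real) ^ Suc k) = 1 - (1/2) ^ n" by (induction n) (auto simp: field_simps)
    then show ?thesis by simp
  qed
  have "\<exists>k<n. y \<le> 2 ^ Suc k * \<bar>u k\<bar>"
  proof (rule ccontr)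
    assume "\<not> ?thesis"
    then have neg: "2 ^ Suc k * \<bar>u k\<bar> < y" if "k < n" for k using that by force
    have "u k \<le> y * (1/2) ^ Suc k" if "k < n" for k
    proof -
      have "2 ^ Suc k * u k \<le> 2 ^ Suc k * \<bar>u k\<bar>" by (intro mult_left_mono) auto
      with neg[OF that] have "2 ^ Suc k * u k \<le> y" by linarith
      then show ?thesis by (simp add: power_one_over field_simps)
    qed
    then have "(\<Sum>k<n. u k) \<le> (\<Sum>k<n. y * (1/2) ^ Suc k)" by (intro sum_mono) auto
    also have "\<dots> = y * (\<Sum>k<n. (1/2) ^ Suc k)" by (simp add: sum_distrib_left)
    also have "\<dots> < y * 1" using geo \<open>0 < y\<close> by (intro mult_strict_left_mono) auto
    finally show False using assms by simp
  qed
  then obtain k where k: "k < n" "y \<le> 2 ^ Suc k * \<bar>u k\<bar>" by blast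
  have "y powr q \<le> (2 ^ Suc k * \<bar>u k\<bar>) powr q" using k assms by (intro powr_mono2) auto
  also have "\<dots> \<le> (\<Sum>k<n. (2 ^ Suc k * \<bar>u k\<bar>) powr q)"
    using k by (intro member_le_sum) auto
  finally show ?thesis .
qed

lemma power_div_fact_le_exp:
  assumes "0 \<le> (x::real)" shows "x ^ k / fact k \<le> exp x"
proof -
  have "(\<Sum>i\<in>{k}. x ^ i / fact i) \<le> (\<Sum>i. x ^ i / fact i)"
    using assms summable_exp[of x] by (intro sum_le_suminf) (auto simp: field_simps)
  then show ?thesis by (simp add: exp_def divide_inverse scaleR_conv_of_real mult.commute)
qed

text \<open>Taylor's formula for \<open>Q (x + h)\<close> is stopped when the remainder is below \<open>L/2\<close>, so that only
  finitely many terms are integrated. With \<open>u = C K \<bar>h\<bar>\<close> the \<open>k\<close>-th term contributes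
  \<open>(2\<^sup>k\<^sup>+\<^sup>1 u\<^sup>k / k!)\<^sup>q\<close>; writing \<open>2\<^sup>k = 2\<^sup>-\<^sup>k 4\<^sup>k\<close> bounds it by a geometric sequence times
  \<open>exp (4 u q)\<close>.\<close>

lemma translation_estimate_finite:
  assumes cont: "continuous_on UNIV \<omega>" and nn: "\<And>t. 0 \<le> \<omega> t" and q: "0 < q" and "0 < C"
    and bern: "\<And>K Q. K\<^sub>0 \<le> K \<Longrightarrow> Q \<in> trig_polys K \<Longrightarrow>
      Lp_norm (ennreal q) \<omega> (deriv Q) \<le> C * real K * Lp_norm (ennreal q) \<omega> Q"
  shows "translation_estimate \<omega> q C K\<^sub>0 (4 powr q / (1 - (1/2) powr q) * pi)"
  unfolding translation_estimate_def
proof (intro allI ballI impI)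
  fix K Q and a d h s c e L E :: real
  assume K: "K\<^sub>0 \<le> K" and Q: "Q \<in> trig_polys K"
    and pos: "0 < d" "d \<le> s" "- pi \<le> a" "a + d \<le> pi" "0 \<le> e" "0 < L" "0 \<le> E"
    and G: "\<forall>x\<in>{a..a+d}. e \<le> \<omega> x \<and> L \<le> \<bar>Q (x + h)\<bar>"
    and U: "\<forall>x\<in>{-pi..pi}. \<bar>Q x\<bar> powr q * \<omega> x \<le> E * (s\<^sup>2 / (s\<^sup>2 + (x - c)\<^sup>2))"
  define I where "I = (\<lambda>f. \<integral>t. \<bar>f t\<bar> powr q * \<omega> t \<partial>circle_measure)"
  define D where "D = (\<lambda>k. (deriv ^^ k) Q)"
  have D: "D k \<in> trig_polys K" for k unfolding D_def by (rule trig_polys_deriv_iter[OF Q])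
  note cD = trig_polys_continuous[OF D, of UNIV]
  have int: "integrable circle_measure (\<lambda>t. \<bar>D k t\<bar> powr q * \<omega> t)" for k
    by (rule integrable_powr_weight[OF q cD cont])
  have I0: "0 \<le> I f" for f unfolding I_def by (intro integral_nonneg_AE) (simp add: nn)
  have step: "I (D (Suc k)) \<le> (C * real K) powr q * I (D k)" for k
  proof -
    have "I (D (Suc k)) powr (1/q) \<le> C * real K * I (D k) powr (1/q)"
      using bern[OF K D[of k]] unfolding Lp_norm_finite[OF q] I_def D_def by simp
    then have "(I (D (Suc k)) powr (1/q)) powr q \<le> (C * real K * I (D k) powr (1/q)) powr q"
      using q by (intro powr_mono2) auto
    then show ?thesis using q I0 \<open>0 < C\<close> by (simp add: powr_powr powr_mult)
  qed
  have iter: "I (D k) \<le> ((C * real K) ^ k) powr q * I Q" for k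
  proof (induction k)
    case 0
    then show ?case by (simp add: D_def)
  next
    case (Suc k)
    have "I (D (Suc k)) \<le> (C * real K) powr q * I (D k)" by (rule step)
    also have "\<dots> \<le> (C * real K) powr q * (((C * real K) ^ k) powr q * I Q)"
      by (intro mult_left_mono Suc.IH) simp
    finally show ?case using \<open>0 < C\<close> by (simp add: powr_mult mult_ac)
  qed
  have s: "0 < s" using pos by simp
  have "I Q \<le> (\<integral>x. E * (s\<^sup>2 / (s\<^sup>2 + (x - c)\<^sup>2)) \<partial>circle_measure)"
    unfolding I_def
  proof (rule integral_mono)
    show "integrable circle_measure (\<lambda>t. \<bar>Q t\<bar> powr q * \<omega> t)" using int[of 0] by (simp add: D_def)
    have "s\<^sup>2 + (x - c)\<^sup>2 \<noteq> 0" for x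
      using add_pos_nonneg[of "s\<^sup>2" "(x - c)\<^sup>2"] s by simp
    then show "integrable circle_measure (\<lambda>x. E * (s\<^sup>2 / (s\<^sup>2 + (x - c)\<^sup>2)))"
      by (intro integrable_circle_measure continuous_intros) auto
  qed (use U in \<open>simp add: space_circle_measure\<close>)
  also have "\<dots> = E * (\<integral>x. s\<^sup>2 / (s\<^sup>2 + (x - c)\<^sup>2) \<partial>circle_measure)" by (rule integral_mult_right_zero)
  also have "\<dots> \<le> E * (pi * s)" by (intro mult_left_mono integral_circle_cauchy_kernel s pos)
  finally have IQ: "I Q \<le> E * (pi * s)" .

  obtain n where n: "\<And>x. \<bar>Q (x + h)\<bar> \<le> (\<Sum>k<n. \<bar>D k x\<bar> * (\<bar>h\<bar> ^ k / fact k)) + L/2"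
    using trig_polys_taylor[OF Q, of "L/2" h] pos unfolding D_def by auto
  define w where "w = (\<lambda>k. (2 ^ Suc k * (\<bar>h\<bar> ^ k / fact k)) powr q)"
  define u where "u = C * real K * \<bar>h\<bar>"
  have u0: "0 \<le> u" using \<open>0 < C\<close> by (simp add: u_def)
  have ptw: "(L/2) powr q \<le> (\<Sum>k<n. w k * \<bar>D k x\<bar> powr q)" if "x \<in> {a..a+d}" for x
  proof -
    have "L/2 \<le> (\<Sum>k<n. \<bar>D k x\<bar> * (\<bar>h\<bar> ^ k / fact k))" using n[of x] bspec[OF G that] by linarith
    from powr_le_sum_powr[OF _ this q] pos
    have "(L/2) powr q \<le> (\<Sum>k<n. (2 ^ Suc k * \<bar>\<bar>D k x\<bar> * (\<bar>h\<bar> ^ k / fact k)\<bar>) powr q)" by simp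
    also have "\<dots> = (\<Sum>k<n. w k * \<bar>D k x\<bar> powr q)"
      unfolding w_def by (intro sum.cong refl) (simp add: powr_mult[symmetric] abs_mult mult_ac)
    finally show ?thesis .
  qed
  have "d * (e * (L/2) powr q) = (\<integral>x. indicator {a..a+d} x * (e * (L/2) powr q) \<partial>circle_measure)"
    by (rule integral_circle_interval(2)[symmetric]) (use pos in auto)
  also have "\<dots> \<le> (\<integral>x. (\<Sum>k<n. w k * (\<bar>D k x\<bar> powr q * \<omega> x)) \<partial>circle_measure)"
  proof (rule integral_mono)
    show "integrable circle_measure (\<lambda>x. indicator {a..a+d} x * (e * (L/2) powr q))"
      by (rule integral_circle_interval) (use pos in auto)
    show "integrable circle_measure (\<lambda>x. \<Sum>k<n. w k * (\<bar>D k x\<bar> powr q * \<omega> x))"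
      by (intro Bochner_Integration.integrable_sum integrable_mult_right int)
    fix x
    show "indicator {a..a+d} x * (e * (L/2) powr q) \<le> (\<Sum>k<n. w k * (\<bar>D k x\<bar> powr q * \<omega> x))"
    proof (cases "x \<in> {a..a+d}")
      case True
      have "e * (L/2) powr q \<le> \<omega> x * (\<Sum>k<n. w k * \<bar>D k x\<bar> powr q)"
        using True G ptw[OF True] nn by (intro mult_mono) auto
      then show ?thesis using True by (simp add: sum_distrib_left mult_ac)
    next
      case False
      then show ?thesis by (auto intro!: sum_nonneg simp: w_def nn)
    qed
  qed
  also have "\<dots> = (\<Sum>k<n. w k * I (D k))"
    unfolding I_def by (subst Bochner_Integration.integral_sum) (auto intro: int)
  also have "\<dots> \<le> (\<Sum>k<n. (2 powr q * exp (4 * u * q) * I Q) * ((1/2) powr q) ^ k)"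
  proof (rule sum_mono)
    fix k
    have "2 ^ Suc k * (\<bar>h\<bar> ^ k / fact k) * (C * real K) ^ k = 2 * (1/2) ^ k * ((4 * u) ^ k / fact k)"
    proof -
      have "(4::real) ^ k = 2 ^ k * 2 ^ k" by (simp flip: power_mult_distrib)
      then show ?thesis by (simp add: u_def power_mult_distrib field_simps)
    qed
    also have "\<dots> \<le> 2 * (1/2) ^ k * exp (4 * u)"
      using u0 by (intro mult_left_mono power_div_fact_le_exp) auto
    finally have "(2 ^ Suc k * (\<bar>h\<bar> ^ k / fact k) * (C * real K) ^ k) powr q \<le> (2 * (1/2) ^ k * exp (4 * u)) powr q"
      using q \<open>0 < C\<close> by (intro powr_mono2) auto
    moreover have "(2 ^ Suc k * (\<bar>h\<bar> ^ k / fact k) * (C * real K) ^ k) powr q = w k * ((C * real K) ^ k) powr q"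
      unfolding w_def using \<open>0 < C\<close> by (subst powr_mult) auto
    moreover have "(2 * (1/2) ^ k * exp (4 * u)) powr q = 2 powr q * exp (4 * u * q) * ((1/2) powr q) ^ k"
    proof -
      have "((1/2) ^ k :: real) powr q = ((1/2) powr q) ^ k"
        by (simp add: powr_powr mult.commute flip: powr_realpow)
      then show ?thesis by (simp add: powr_mult exp_powr_real mult_ac)
    qed
    ultimately have wk: "w k * ((C * real K) ^ k) powr q \<le> 2 powr q * exp (4 * u * q) * ((1/2) powr q) ^ k" by simp
    have "w k * I (D k) \<le> w k * (((C * real K) ^ k) powr q * I Q)"
      by (intro mult_left_mono iter) (simp add: w_def)
    also have "\<dots> = (w k * ((C * real K) ^ k) powr q) * I Q" by simp
    also have "\<dots> \<le> (2 powr q * exp (4 * u * q) * ((1/2) powr q) ^ k) * I Q"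
      by (intro mult_right_mono wk I0)
    finally show "w k * I (D k) \<le> (2 powr q * exp (4 * u * q) * I Q) * ((1/2) powr q) ^ k" by (simp add: mult_ac)
  qed
  also have "\<dots> = (2 powr q * exp (4 * u * q) * I Q) * (\<Sum>k<n. ((1/2) powr q) ^ k)"
    by (simp add: sum_distrib_left)
  also have "\<dots> \<le> (2 powr q * exp (4 * u * q) * (E * (pi * s))) * (1 / (1 - (1/2) powr q))"
  proof (intro mult_mono)
    have r: "(1/2) powr q < 1" using q powr_less_mono2[of q "1/2" 1] by simp
    then have "(\<Sum>k<n. ((1/2) powr q) ^ k) = (1 - ((1/2) powr q) ^ n) / (1 - (1/2) powr q)"
      by (subst sum_gp_strict) auto
    also have "\<dots> \<le> 1 / (1 - (1/2) powr q)" using r by (intro divide_right_mono) auto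
    finally show "(\<Sum>k<n. ((1/2) powr q) ^ k) \<le> 1 / (1 - (1/2) powr q)" .
  qed (use IQ pos I0[of Q] in \<open>auto intro!: sum_nonneg\<close>)
  finally have fin: "d * (e * (L/2) powr q) \<le> (2 powr q * exp (4 * u * q) * (E * (pi * s))) * (1 / (1 - (1/2) powr q))" .
  have "d * e * L powr q = 2 powr q * (d * (e * (L/2) powr q))"
    using pos by (simp add: powr_divide)
  also have "\<dots> \<le> 2 powr q * ((2 powr q * exp (4 * u * q) * (E * (pi * s))) * (1 / (1 - (1/2) powr q)))"
    by (intro mult_left_mono fin) simp
  also have "\<dots> = (4 powr q / (1 - (1/2) powr q) * pi) * exp (4 * C * K * \<bar>h\<bar> * q) * E * s"
  proof -
    have "(4::real) powr q = 2 powr q * 2 powr q" by (simp flip: powr_mult)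
    moreover have "4 * C * K * \<bar>h\<bar> * q = 4 * u * q" by (simp add: u_def)
    ultimately show ?thesis by (simp only: mult_ac times_divide_eq_left times_divide_eq_right mult_1_left)
  qed
  finally show "d * e * L powr q \<le> (4 powr q / (1 - (1/2) powr q) * pi) * exp (4 * C * K * \<bar>h\<bar> * q) * E * s" .
qed

text \<open>Here a single point of \<open>[a, a + d]\<close> suffices at which all derivatives obey their essential
  bounds; the Cauchy kernel enters only through its maximum 1.\<close>

lemma translation_estimate_infinity:
  assumes cont: "continuous_on UNIV \<omega>" and nn: "\<And>t. 0 \<le> \<omega> t" and "0 < C"
    and bern: "\<And>K Q. K\<^sub>0 \<le> K \<Longrightarrow> Q \<in> trig_polys K \<Longrightarrow>
      Lp_norm \<infinity> \<omega> (deriv Q) \<le> C * real K * Lp_norm \<infinity> \<omega> Q"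
  shows "translation_estimate \<omega> 1 C K\<^sub>0 2"
  unfolding translation_estimate_def
proof (intro allI ballI impI)
  fix K Q and a d h s c e L E :: real
  assume K: "K\<^sub>0 \<le> K" and Q: "Q \<in> trig_polys K"
    and pos: "0 < d" "d \<le> s" "- pi \<le> a" "a + d \<le> pi" "0 \<le> e" "0 < L" "0 \<le> E"
    and G: "\<forall>x\<in>{a..a+d}. e \<le> \<omega> x \<and> L \<le> \<bar>Q (x + h)\<bar>"
    and U: "\<forall>x\<in>{-pi..pi}. \<bar>Q x\<bar> powr 1 * \<omega> x \<le> E * (s\<^sup>2 / (s\<^sup>2 + (x - c)\<^sup>2))"
  define D where "D = (\<lambda>k. (deriv ^^ k) Q)"
  have D: "D k \<in> trig_polys K" for k unfolding D_def by (rule trig_polys_deriv_iter[OF Q])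
  note N = Lp_norm_infinity[OF trig_polys_continuous[OF D] cont]
  have NQ: "Lp_norm \<infinity> \<omega> Q \<le> E"
  proof -
    have "\<bar>Q x * \<omega> x\<bar> \<le> E" if "x \<in> {-pi..pi}" for x
    proof -
      have "\<bar>Q x * \<omega> x\<bar> \<le> E * (s\<^sup>2 / (s\<^sup>2 + (x - c)\<^sup>2))" using U that nn[of x] by (simp add: abs_mult)
      also have "\<dots> \<le> E * 1" using pos by (intro mult_left_mono) (auto simp: divide_le_eq_1 add_pos_nonneg)
      finally show ?thesis by simp
    qed
    then have "AE x in circle_measure. \<bar>D 0 x * \<omega> x\<bar> \<le> E"
      by (intro AE_I2) (simp add: space_circle_measure D_def)
    from N(3)[OF this] show ?thesis by (simp add: D_def)
  qed
  have iter: "Lp_norm \<infinity> \<omega> (D k) \<le> (C * real K) ^ k * E" for k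
  proof (induction k)
    case 0
    then show ?case using NQ by (simp add: D_def)
  next
    case (Suc k)
    have "Lp_norm \<infinity> \<omega> (D (Suc k)) \<le> C * real K * Lp_norm \<infinity> \<omega> (D k)"
      using bern[OF K D[of k]] by (simp add: D_def)
    also have "\<dots> \<le> C * real K * ((C * real K) ^ k * E)"
      using \<open>0 < C\<close> by (intro mult_left_mono Suc.IH) auto
    finally show ?case by (simp add: mult_ac)
  qed
  have AE: "AE x in circle_measure. \<forall>k. \<bar>D k x * \<omega> x\<bar> \<le> Lp_norm \<infinity> \<omega> (D k)"
    unfolding AE_all_countable using N(1) by blast
  obtain x where x: "x \<in> {a..a+d}" "\<And>k. \<bar>D k x * \<omega> x\<bar> \<le> Lp_norm \<infinity> \<omega> (D k)"
    using AE_circle_interval[OF AE pos(3,4,1)] by blast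
  obtain n where n: "\<bar>Q (x + h)\<bar> \<le> (\<Sum>k<n. \<bar>D k x\<bar> * (\<bar>h\<bar> ^ k / fact k)) + L/2"
    using trig_polys_taylor[OF Q, of "L/2" h] pos unfolding D_def by auto
  define u where "u = C * real K * \<bar>h\<bar>"
  have u0: "0 \<le> u" using \<open>0 < C\<close> by (simp add: u_def)
  have "L/2 \<le> (\<Sum>k<n. \<bar>D k x\<bar> * (\<bar>h\<bar> ^ k / fact k))" using n bspec[OF G x(1)] by linarith
  then have "e * (L/2) \<le> \<omega> x * (\<Sum>k<n. \<bar>D k x\<bar> * (\<bar>h\<bar> ^ k / fact k))"
    using G x(1) nn pos by (intro mult_mono) auto
  also have "\<dots> = (\<Sum>k<n. \<bar>D k x * \<omega> x\<bar> * (\<bar>h\<bar> ^ k / fact k))"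
    using nn[of x] by (simp add: sum_distrib_left abs_mult mult_ac)
  also have "\<dots> \<le> (\<Sum>k<n. ((C * real K) ^ k * E) * (\<bar>h\<bar> ^ k / fact k))"
    by (intro sum_mono mult_right_mono order.trans[OF x(2) iter]) auto
  also have "\<dots> = E * (\<Sum>k<n. u ^ k / fact k)"
    by (simp add: sum_distrib_left u_def power_mult_distrib mult_ac)
  also have "\<dots> \<le> E * exp u"
  proof (intro mult_left_mono pos)
    have "(\<Sum>k<n. u ^ k / fact k) \<le> (\<Sum>k. u ^ k / fact k)"
      using u0 summable_exp[of u] by (intro sum_le_suminf) (auto simp: field_simps)
    then show "(\<Sum>k<n. u ^ k / fact k) \<le> exp u"
      by (simp add: exp_def divide_inverse scaleR_conv_of_real mult.commute)
  qed
  also have "\<dots> \<le> E * exp (4 * u)" using u0 pos by (intro mult_left_mono) auto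
  finally have eL: "e * L \<le> 2 * E * exp (4 * u)" by simp
  have "d * (e * L) \<le> s * (2 * E * exp (4 * u))"
    by (rule mult_mono[OF _ eL]) (use pos in auto)
  then show "d * e * L powr 1 \<le> 2 * exp (4 * C * K * \<bar>h\<bar> * 1) * E * s"
    using pos by (simp add: u_def mult_ac)
qed

section \<open>Sudden drops of the weight\<close>

text \<open>If \<open>- ln \<omega>\<close> grows by a factor \<open>M\<^sup>k\<close> from \<open>t\<close> to \<open>r t\<close>, then it grows by a factor
  \<open>M\<close> between two neighbours of the sequence \<open>t, \<rho> t, \<dots>, \<rho>\<^sup>k t\<close>, where \<open>\<rho>\<^sup>k \<le> r\<close>. Hence the
  ratio \<open>r\<close> of the hypothesis can be replaced by any \<open>\<rho> < 1\<close>.\<close>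

lemma drop_at_any_ratio:
  fixes \<omega> :: "real \<Rightarrow> real"
  assumes "0 < \<epsilon>" and mono: "mono_on {0<..<\<epsilon>} \<omega>" and pos: "\<And>t. 0 < t \<Longrightarrow> t < \<epsilon> \<Longrightarrow> 0 < \<omega> t"
    and lim: "(\<omega> \<longlongrightarrow> 0) (at_right 0)"
    and r: "0 < r" "r < 1"
    and unb: "\<And>N \<tau>. 0 < \<tau> \<Longrightarrow> \<exists>t. 0 < t \<and> t < \<tau> \<and> N < ln (\<omega> (r * t)) / ln (\<omega> t)"
    and \<rho>: "0 < \<rho>" "\<rho> < 1" and "0 < M" "0 < \<tau>"
  shows "\<exists>t. 0 < t \<and> t < \<tau> \<and> 0 < \<omega> t \<and> \<omega> t < \<tau> \<and> \<omega> (\<rho> * t) \<le> \<omega> t powr M"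
proof -
  obtain k where k: "\<rho> ^ k < r" using real_arch_pow_inv[OF r(1) \<rho>(2)] by blast
  have "\<forall>\<^sub>F t in at_right 0. \<omega> t < min \<tau> 1"
    using lim \<open>0 < \<tau>\<close> by (intro order_tendstoD) auto
  then obtain b where b: "0 < b" "\<And>t. 0 < t \<Longrightarrow> t < b \<Longrightarrow> \<omega> t < min \<tau> 1"
    unfolding eventually_at_right_field by auto
  define \<delta> where "\<delta> = min b (min \<epsilon> \<tau>)"
  have "0 < \<delta>" using b \<open>0 < \<epsilon>\<close> \<open>0 < \<tau>\<close> by (simp add: \<delta>_def)
  then obtain t where t: "0 < t" "t < \<delta>" "M ^ k < ln (\<omega> (r * t)) / ln (\<omega> t)" using unb by blast
  have small: "0 < u \<Longrightarrow> u \<le> t \<Longrightarrow> 0 < \<omega> u \<and> \<omega> u < min \<tau> 1" for u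
    using pos b t unfolding \<delta>_def by auto
  have seq: "0 < \<rho> ^ i * t" "\<rho> ^ i * t \<le> t" for i
    using \<rho> t by (auto simp: mult_le_cancel_right1 power_le_one)
  have "\<exists>i<k. \<omega> (\<rho> ^ Suc i * t) \<le> \<omega> (\<rho> ^ i * t) powr M"
  proof (rule ccontr)
    assume neg: "\<not> ?thesis"
    have "- ln (\<omega> (\<rho> ^ i * t)) \<le> M ^ i * - ln (\<omega> t)" if "i \<le> k" for i
      using that
    proof (induction i)
      case (Suc i)
      have "i < k" using Suc.prems by simp
      with neg have "\<omega> (\<rho> ^ i * t) powr M \<le> \<omega> (\<rho> ^ Suc i * t)" by (meson linear)
      then have "ln (\<omega> (\<rho> ^ i * t) powr M) \<le> ln (\<omega> (\<rho> ^ Suc i * t))"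
        using small[OF seq[of i]] by (intro ln_mono) auto
      then have "- ln (\<omega> (\<rho> ^ Suc i * t)) \<le> M * - ln (\<omega> (\<rho> ^ i * t))"
        using small[OF seq[of i]] by (simp add: ln_powr)
      also have "\<dots> \<le> M * (M ^ i * - ln (\<omega> t))"
        using Suc \<open>0 < M\<close> by (intro mult_left_mono) auto
      finally show ?case by (simp add: mult_ac)
    qed simp
    then have 1: "- ln (\<omega> (\<rho> ^ k * t)) \<le> M ^ k * - ln (\<omega> t)" by simp
    have neg_ln: "ln (\<omega> t) < 0" using small[of t] t by simp
    then have 2: "M ^ k * - ln (\<omega> t) < - ln (\<omega> (r * t))"
      using t(3) by (simp add: neg_less_divide_eq)
    have rt: "0 < r * t" "r * t \<le> t" using r t by (auto simp: mult_le_cancel_right1)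
    have kr: "\<rho> ^ k * t \<le> r * t" using k t by (intro mult_right_mono) auto
    have "\<omega> (\<rho> ^ k * t) \<le> \<omega> (r * t)"
    proof (rule mono_onD[OF mono])
      have "t < \<epsilon>" using t by (simp add: \<delta>_def)
      then show "\<rho> ^ k * t \<in> {0<..<\<epsilon>}" "r * t \<in> {0<..<\<epsilon>}"
        using seq(1)[of k] rt kr unfolding greaterThanLessThan_iff by linarith+
    qed (rule kr)
    then have "ln (\<omega> (\<rho> ^ k * t)) \<le> ln (\<omega> (r * t))"
      using small[OF seq[of k]] by (intro ln_mono) auto
    with 1 2 show False by linarith
  qed
  then obtain i where i: "\<omega> (\<rho> ^ Suc i * t) \<le> \<omega> (\<rho> ^ i * t) powr M" by blast
  have "\<rho> ^ i * t < \<tau>" using seq[of i] t unfolding \<delta>_def by linarith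
  with i small[OF seq[of i]] seq[of i] show ?thesis
    by (intro exI[of _ "\<rho> ^ i * t"]) (auto simp: mult.assoc)
qed

text \<open>The bump over the arc \<open>[0, s]\<close> with \<open>t = (1 + \<sigma>\<^sup>2) s\<close> refutes the estimate. Its degree \<open>K\<close> is
  taken as large as the drop from \<open>\<omega> t = e\<^sup>-\<^sup>A\<close> to \<open>\<omega> s \<le> e\<^sup>-\<^sup>M\<^sup>A\<close> permits, \<open>q K s \<approx> M A\<close>. At depth
  \<open>\<sigma>\<^sup>2 s\<close> below the end of the arc the bump has exponent of order \<open>\<sigma> K s\<close>, whereas translating from
  there to \<open>t\<close> costs only an exponent of order \<open>C \<sigma>\<^sup>2 K s\<close>. For small \<open>\<sigma>\<close> the gain prevails, and
  it exceeds \<open>A\<close> because \<open>\<sigma> M\<close> is large.\<close>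

lemma translation_estimate_contradicts_drops:
  assumes T: "translation_estimate \<omega> q C K\<^sub>0 B" and q: "0 < q" and C: "0 < C" and B: "0 < B"
    and nn: "\<And>t. 0 \<le> \<omega> t" and W: "\<And>x. -pi \<le> x \<Longrightarrow> x \<le> pi \<Longrightarrow> \<omega> x \<le> W"
    and \<epsilon>: "0 < \<epsilon>" and mono: "mono_on {0<..<\<epsilon>} \<omega>" and \<omega>0: "\<omega> 0 = 0"
    and drop: "\<And>\<rho> M \<tau>. 0 < \<rho> \<Longrightarrow> \<rho> < 1 \<Longrightarrow> 0 < M \<Longrightarrow> 0 < \<tau> \<Longrightarrow>
      \<exists>t. 0 < t \<and> t < \<tau> \<and> 0 < \<omega> t \<and> \<omega> t < \<tau> \<and> \<omega> (\<rho> * t) \<le> \<omega> t powr M"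
  shows False
proof -
  have W0: "0 \<le> W" using W[of 0] \<omega>0 by simp
  \<comment> \<open>\<open>2jq \<ge> 2\<close>, so that the \<open>q\<close>-th power of the bump decays quadratically\<close>
  define j where "j = nat \<lceil>1 / q\<rceil>"
  have j: "1 \<le> real j * q" "0 < real j"
  proof -
    have "1 / q \<le> real j" unfolding j_def by linarith
    then show "1 \<le> real j * q" using q by (simp add: field_simps)
    then show "0 < real j" by (cases "j = 0") auto
  qed
  \<comment> \<open>192 makes the translation cost \<open>12 C \<sigma>\<^sup>2\<close> at most half of the gain \<open>\<sigma>/8\<close>, and 64 then makes the
    net gain at least \<open>2A\<close>\<close>
  define \<sigma> where "\<sigma> = min (1/2) (1 / (192 * C))"
  have \<sigma>: "0 < \<sigma>" "\<sigma> \<le> 1/2" "192 * C * \<sigma> \<le> 1"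
  proof -
    have "\<sigma> \<le> 1 / (192 * C)" by (simp add: \<sigma>_def)
    then show "192 * C * \<sigma> \<le> 1" using C by (simp add: field_simps)
  qed (use C in \<open>simp_all add: \<sigma>_def\<close>)
  define \<eta> where "\<eta> = \<sigma>\<^sup>2"
  have \<eta>: "0 < \<eta>" "\<eta> \<le> 1/4"
    using \<sigma> power_mono[of \<sigma> "1/2" 2] unfolding \<eta>_def by (auto simp: power2_eq_square)
  define M where "M = 64 / \<sigma>"
  have M: "0 < M" "\<sigma> * M = 64" using \<sigma> by (simp_all add: M_def)
  define l where "l = ((1/4) ^ j) powr q"
  have l: "0 < l" by (simp add: l_def)
  define R where "R = B * (5 * (W + 1)) / (\<eta> * l)"
  have R: "0 < R" unfolding R_def using B W0 \<eta> l by simp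
  define N where "N = real K\<^sub>0"
  have N: "0 \<le> N" by (simp add: N_def)
  define A\<^sub>0 where "A\<^sub>0 = 2 * real j * q * (8 + N) / M"
  define \<tau> where "\<tau> = Min {exp (- A\<^sub>0), 1 / R, \<epsilon> / 2, 1 / 4}"
  have \<tau>: "0 < \<tau>" "\<tau> \<le> exp (- A\<^sub>0)" "\<tau> \<le> 1 / R" "\<tau> \<le> \<epsilon> / 2" "\<tau> \<le> 1 / 4"
    using R \<epsilon> by (auto simp: \<tau>_def)
  obtain t where t: "0 < t" "t < \<tau>" "0 < \<omega> t" "\<omega> t < \<tau>" "\<omega> (1 / (1 + \<eta>) * t) \<le> \<omega> t powr M"
    using drop[of "1 / (1 + \<eta>)" M \<tau>] \<eta> M \<tau> by auto
  define s where "s = 1 / (1 + \<eta>) * t"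
  have "s * (1 + \<eta>) = t" using \<eta> by (simp add: s_def)
  then have ts: "t = s + \<eta> * s" by (simp add: algebra_simps)
  have s: "0 < s" "s \<le> t" "s \<le> 1/2" "0 < \<eta> * s" "\<eta> * s \<le> s"
  proof -
    show s0: "0 < s" using t \<eta> by (simp add: s_def)
    then show "0 < \<eta> * s" using \<eta> by simp
    with ts show "s \<le> t" by linarith
    with t \<tau> show "s \<le> 1/2" by linarith
    show "\<eta> * s \<le> s" using s0 \<eta> mult_right_mono[of \<eta> 1 s] by simp
  qed
  define A where "A = - ln (\<omega> t)"
  have \<omega>t: "\<omega> t = exp (- A)" using t by (simp add: A_def)
  have "exp (- A) < exp (- A\<^sub>0)" using t \<tau> unfolding \<omega>t[symmetric] by linarith
  then have A: "A\<^sub>0 < A" by simp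
  have MA: "2 * real j * q * (8 + N) \<le> M * A"
    using A M unfolding A\<^sub>0_def by (simp add: divide_less_eq mult.commute)
  \<comment> \<open>the largest \<open>m\<close> for which the bump of degree \<open>2jm\<close>, of height at most \<open>e\<^sup>2\<^sup>j\<^sup>m\<^sup>s\<close>, is
    compensated by the weight on \<open>[0, s]\<close>\<close>
  define y where "y = M * A / (2 * real j * q * s)"
  define m where "m = nat \<lfloor>y\<rfloor>"
  have den: "0 < 2 * real j * q" using j q by simp
  have ys: "8 + N \<le> y * s"
  proof -
    have "y * s = M * A / (2 * real j * q)" using s by (simp add: y_def)
    then show ?thesis using MA den by (simp add: pos_le_divide_eq mult.commute)
  qed
  have y2: "16 + 2 * N \<le> y"
  proof -
    have "0 \<le> y"
    proof (rule ccontr)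
      assume "\<not> 0 \<le> y"
      then have "y * s \<le> 0" using s by (simp add: mult_nonpos_nonneg)
      with ys N show False by simp
    qed
    then have "y * s \<le> y * (1/2)" using s by (intro mult_left_mono) auto
    then have "y * s \<le> y / 2" by simp
    then have "2 * (y * s) \<le> y" by simp
    with ys show ?thesis by linarith
  qed
  have m: "real m \<le> y" "y / 2 \<le> real m" using y2 N unfolding m_def by linarith+
  have Kq: "real (2 * j * m) * s * q \<le> M * A" "M * A / 2 \<le> real (2 * j * m) * s * q"
  proof -
    have eq: "2 * real j * q * s * y = M * A" using s j q by (simp add: y_def)
    have "2 * real j * q * s * real m \<le> 2 * real j * q * s * y"
      using m s den by (intro mult_left_mono) auto
    then show "real (2 * j * m) * s * q \<le> M * A" unfolding eq by (simp add: mult_ac)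
    have "2 * real j * q * s * (y / 2) \<le> 2 * real j * q * s * real m"
      using m s den by (intro mult_left_mono) auto
    moreover have "2 * real j * q * s * (y / 2) = M * A / 2" using eq by simp
    ultimately show "M * A / 2 \<le> real (2 * j * m) * s * q" by (simp add: mult_ac)
  qed
  define K where "K = 2 * j * m"
  have "K\<^sub>0 \<le> m" using m y2 by (simp add: N_def)
  also have "m \<le> K" using j unfolding K_def by simp
  finally have K: "K\<^sub>0 \<le> K" .
  have ms: "8 \<le> (2 * real m + 1) * s"
  proof -
    have "y * s \<le> (2 * real m) * s" using m s by (intro mult_right_mono) auto
    with ys s(1) N show ?thesis unfolding distrib_right by linarith
  qed

  let ?Q = "bump s m j"
  define L where "L = (1/4) ^ j * exp (real K * (\<sigma> * s / 8))"
  \<comment> \<open>The shift \<open>-3\<eta>s\<close> moves \<open>[t, t + \<eta>s]\<close>, where \<open>\<omega> \<ge> \<omega> t\<close>, to \<open>[s - 2\<eta>s, s - \<eta>s]\<close>, where the bump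
    is bounded below by \<open>L\<close>.\<close>
  have est: "\<eta> * s * \<omega> t * L powr q \<le> B * exp (4 * C * real K * \<bar>- (3 * (\<eta> * s))\<bar> * q) * (5 * (W + 1)) * s"
  proof (rule translation_estimateD[OF T K, where Q = ?Q and a = t and c = "s/2"])
    show "?Q \<in> trig_polys K" unfolding K_def by (rule bump_trig_polys)
    show "t + \<eta> * s \<le> pi" using t \<tau> s pi_gt3 by linarith
    show "- pi \<le> t" using t pi_gt3 by linarith
    show "0 < L" by (simp add: L_def)
    show "\<omega> t \<le> \<omega> x" if "x \<in> {t..t + \<eta> * s}" for x
      using that t \<tau> s by (intro mono_onD[OF mono]) auto
    show "L \<le> \<bar>?Q (x + - (3 * (\<eta> * s)))\<bar>" if "x \<in> {t..t + \<eta> * s}" for x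
    proof -
      have "L \<le> ?Q (x + - (3 * (\<eta> * s)))"
        unfolding L_def K_def
        by (rule bump_lower) (use s \<sigma> ts that in \<open>auto simp: \<eta>_def[symmetric] mult.assoc\<close>)
      then show ?thesis by linarith
    qed
    show "\<bar>?Q x\<bar> powr q * \<omega> x \<le> 5 * (W + 1) * (s\<^sup>2 / (s\<^sup>2 + (x - s/2)\<^sup>2))" if x: "x \<in> {-pi..pi}" for x
    proof -
      define z where "z = x - s/2"
      define k where "k = s\<^sup>2 / (s\<^sup>2 + z\<^sup>2)"
      have den': "0 < s\<^sup>2 + z\<^sup>2" using s by (intro add_pos_nonneg) auto
      have k0: "0 < k" using s den' by (simp add: k_def)
      have near: "1 \<le> 5 * k" if "\<bar>z\<bar> \<le> 2 * s"
      proof -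
        have "z\<^sup>2 \<le> (2 * s)\<^sup>2" using that s by (intro abs_le_square_iff[THEN iffD1]) simp
        then show ?thesis unfolding k_def using den' by (simp add: pos_le_divide_eq)
      qed
      \<comment> \<open>on the arc the smallness of the weight compensates for the bump, near it the Cauchy kernel is
        bounded below, and far from the arc the bump decays at least as fast as the kernel\<close>
      consider "x \<in> {0..s}" | "x \<notin> {0..s}" "\<bar>z\<bar> \<le> 2 * s" | "2 * s < \<bar>z\<bar>" by linarith
      then have "\<bar>?Q x\<bar> powr q * \<omega> x \<le> (W + 1) * (5 * k)"
      proof cases
        case 1
        have "\<omega> x \<le> exp (- (M * A))"
        proof (cases "x = 0")
          case False
          then have "\<omega> x \<le> \<omega> s"
            using 1 s t \<tau> by (intro mono_onD[OF mono]) auto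
          also have "\<dots> \<le> \<omega> t powr M" using t by (simp add: s_def)
          also have "\<dots> = exp (- (M * A))" unfolding \<omega>t by (simp add: exp_powr_real mult.commute)
          finally show ?thesis .
        qed (simp add: \<omega>0)
        moreover have "\<bar>?Q x\<bar> powr q \<le> exp (M * A)"
        proof -
          have "\<bar>?Q x\<bar> powr q \<le> exp (real (2 * j * m) * s) powr q"
            using q by (intro powr_mono2 bump_le_exp[OF s(1,3) 1]) auto
          also have "\<dots> \<le> exp (M * A)" using Kq(1) by (simp add: exp_powr_real)
          finally show ?thesis .
        qed
        ultimately have "\<bar>?Q x\<bar> powr q * \<omega> x \<le> exp (M * A) * exp (- (M * A))"
          using nn by (intro mult_mono) auto
        also have "\<dots> = 1" by (simp add: exp_minus)
        also have "\<dots> \<le> 5 * k" using 1 s by (intro near) (auto simp: z_def abs_le_iff)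
        also have "\<dots> \<le> (W + 1) * (5 * k)" using W0 k0 by (simp add: distrib_right)
        finally show ?thesis .
      next
        case 2
        have "\<bar>?Q x\<bar> powr q \<le> 1 powr q"
          using q x 2 by (intro powr_mono2 bump_le_1[OF s(1,3)]) auto
        then have "\<bar>?Q x\<bar> powr q * \<omega> x \<le> 1 * W" using x nn W by (intro mult_mono) auto
        also have "\<dots> \<le> (W + 1) * 1" by simp
        also have "\<dots> \<le> (W + 1) * (5 * k)" using near[OF 2(2)] W0 by (intro mult_left_mono) auto
        finally show ?thesis .
      next
        case 3
        have z: "0 < \<bar>z\<bar>" using 3 s by linarith
        have "\<bar>?Q x\<bar> powr q \<le> ((s / \<bar>z\<bar>) ^ (2 * j)) powr q"
          unfolding z_def using q x 3 ms by (intro powr_mono2 bump_decay[OF s(1,3)]) (auto simp: z_def)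
        also have "\<dots> = (s / \<bar>z\<bar>) powr (real (2 * j) * q)"
          using s z by (simp add: powr_powr flip: powr_realpow)
        also have "\<dots> \<le> (s / \<bar>z\<bar>) powr 2"
          using 3 s z j by (intro powr_mono') auto
        also have "\<dots> = s\<^sup>2 / z\<^sup>2" using s z by (simp add: power_divide)
        also have "\<dots> \<le> 5 * k"
        proof -
          have "s\<^sup>2 \<le> z\<^sup>2" using 3 s by (intro abs_le_square_iff[THEN iffD1]) auto
          then have "s\<^sup>2 + z\<^sup>2 \<le> 5 * z\<^sup>2" using zero_le_power2[of z] by linarith
          then have "s\<^sup>2 * (s\<^sup>2 + z\<^sup>2) \<le> s\<^sup>2 * (5 * z\<^sup>2)" by (intro mult_left_mono) auto
          then show ?thesis unfolding k_def using z den' by (simp add: divide_le_eq pos_le_divide_eq mult_ac)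
        qed
        finally have "\<bar>?Q x\<bar> powr q * \<omega> x \<le> (5 * k) * (W + 1)"
          using x nn W[of x] k0 by (intro mult_mono) auto
        then show ?thesis by (simp add: mult.commute)
      qed
      then show ?thesis unfolding k_def z_def by (simp only: mult_ac)
    qed
  qed (use s W0 t in auto)
  define v where "v = \<sigma> * (real K * s * q)"
  have Lq: "L powr q = l * exp (v / 8)"
    unfolding L_def l_def v_def by (simp add: powr_mult exp_powr_real mult_ac)
  have cost: "4 * C * real K * \<bar>- (3 * (\<eta> * s))\<bar> * q \<le> v / 16"
  proof -
    have "4 * C * real K * \<bar>- (3 * (\<eta> * s))\<bar> * q = (192 * C * \<sigma>) * (v / 16)"
      using s \<eta> by (simp add: v_def \<eta>_def power2_eq_square abs_mult)
    also have "\<dots> \<le> 1 * (v / 16)"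
      using \<sigma> s q by (intro mult_right_mono) (auto simp: v_def)
    finally show ?thesis by simp
  qed
  have "\<eta> * s * \<omega> t * (l * exp (v / 8)) \<le> B * exp (v / 16) * (5 * (W + 1)) * s"
  proof (rule order.trans[OF est[unfolded Lq]])
    show "B * exp (4 * C * real K * \<bar>- (3 * (\<eta> * s))\<bar> * q) * (5 * (W + 1)) * s \<le> B * exp (v / 16) * (5 * (W + 1)) * s"
      using cost B W0 s by (intro mult_right_mono mult_left_mono) auto
  qed
  moreover have "exp (v / 8) = exp (v / 16) * exp (v / 16)" by (simp flip: exp_add)
  ultimately have "(\<omega> t * exp (v / 16)) * (\<eta> * l * s * exp (v / 16)) \<le> (B * (5 * (W + 1))) * (s * exp (v / 16))"
    by (simp add: mult_ac)
  then have "(\<omega> t * exp (v / 16)) * (\<eta> * l) \<le> B * (5 * (W + 1))"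
    using s by (simp add: mult_ac)
  then have up: "\<omega> t * exp (v / 16) \<le> R"
    unfolding R_def using \<eta> l by (simp add: pos_le_divide_eq)
  have "\<sigma> * (M * A / 2) \<le> v"
    unfolding v_def K_def using Kq(2) \<sigma> by (intro mult_left_mono) auto
  then have "32 * A \<le> v" using M(2) by (simp flip: mult.assoc)
  then have "exp (- A) * exp (2 * A) \<le> \<omega> t * exp (v / 16)" unfolding \<omega>t by simp
  with up have "exp A \<le> R" by (simp flip: exp_add)
  then have "1 / R \<le> exp (- A)" using R by (simp add: exp_minus field_simps)
  then show False using t(4) \<tau>(3) unfolding \<omega>t by linarith
qed

lemma Limsup_infinity_one_side:
  fixes g :: "real \<Rightarrow> real"
  assumes "Limsup (at 0) (\<lambda>t. ereal (g t)) = \<infinity>"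
  shows "(\<forall>N. \<forall>\<tau>>0. \<exists>t. 0 < t \<and> t < \<tau> \<and> N < g t) \<or> (\<forall>N. \<forall>\<tau>>0. \<exists>t. 0 < t \<and> t < \<tau> \<and> N < g (- t))"
proof (rule ccontr)
  assume "\<not> ?thesis"
  then obtain N\<^sub>1 \<tau>\<^sub>1 N\<^sub>2 \<tau>\<^sub>2 where N: "0 < \<tau>\<^sub>1" "\<And>t. 0 < t \<Longrightarrow> t < \<tau>\<^sub>1 \<Longrightarrow> g t \<le> N\<^sub>1"
    "0 < \<tau>\<^sub>2" "\<And>t. 0 < t \<Longrightarrow> t < \<tau>\<^sub>2 \<Longrightarrow> g (- t) \<le> N\<^sub>2"
    unfolding not_less[symmetric] by blast
  have "\<forall>\<^sub>F t in at 0. ereal (g t) \<le> ereal (max N\<^sub>1 N\<^sub>2)"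
    unfolding eventually_at
  proof (intro exI[of _ "min \<tau>\<^sub>1 \<tau>\<^sub>2"] conjI ballI impI)
    fix t :: real assume t: "t \<noteq> 0 \<and> dist t 0 < min \<tau>\<^sub>1 \<tau>\<^sub>2"
    show "ereal (g t) \<le> ereal (max N\<^sub>1 N\<^sub>2)"
      using N(2)[of t] N(4)[of "- t"] t by (cases "0 < t") (auto simp: le_max_iff_disj)
  qed (use N in auto)
  then have "Limsup (at 0) (\<lambda>t. ereal (g t)) \<le> ereal (max N\<^sub>1 N\<^sub>2)" by (rule Limsup_bounded)
  with assms show False by (simp flip: ereal_max)
qed

lemma translation_estimate_contradicts_limsup:
  assumes T: "translation_estimate \<omega> q C K\<^sub>0 B" and q: "0 < q" and C: "0 < C" and B: "0 < B"
    and nn: "\<And>t. 0 \<le> \<omega> t" and cont: "continuous_on UNIV \<omega>"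
    and \<epsilon>: "0 < \<epsilon>" and mono: "mono_on {0<..<\<epsilon>} \<omega>" and \<omega>0: "\<omega> 0 = 0"
    and pos: "\<And>t. 0 < t \<Longrightarrow> t < \<epsilon> \<Longrightarrow> 0 < \<omega> t"
    and r: "0 < r" "r < 1"
    and unb: "\<And>N \<tau>. 0 < \<tau> \<Longrightarrow> \<exists>t. 0 < t \<and> t < \<tau> \<and> N < ln (\<omega> (r * t)) / ln (\<omega> t)"
  shows False
proof -
  have "\<exists>x\<in>{-pi..pi}. \<forall>y\<in>{-pi..pi}. \<omega> y \<le> \<omega> x"
    using pi_gt3 by (intro continuous_attains_sup continuous_on_subset[OF cont]) auto
  then obtain z where "\<forall>y\<in>{-pi..pi}. \<omega> y \<le> \<omega> z" by blast
  then have W: "\<And>x. -pi \<le> x \<Longrightarrow> x \<le> pi \<Longrightarrow> \<omega> x \<le> \<omega> z" by auto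
  have "(\<omega> \<longlongrightarrow> \<omega> 0) (at 0)" using cont by (simp add: continuous_on_def)
  then have lim: "(\<omega> \<longlongrightarrow> 0) (at_right 0)"
    unfolding \<omega>0 by (rule filterlim_mono) (auto simp: at_le)
  show False
    by (rule translation_estimate_contradicts_drops[OF T q C B nn W \<epsilon> mono \<omega>0
          drop_at_any_ratio[OF \<epsilon> mono pos lim r unb]])
qed

section \<open>Failure of the Bernstein inequality\<close>

theorem theorem1p2:
  fixes \<omega> :: "real \<Rightarrow> real" and p :: ennreal
  assumes "weight \<omega>" and "continuous_on UNIV \<omega>"
    and "\<exists>\<epsilon>>0. antimono_on {-\<epsilon><..<0} \<omega> \<and> \<omega> 0 = 0 \<and> mono_on {0<..<\<epsilon>} \<omega>"
    and "\<forall>\<^sub>F t in at 0. 0 < \<omega> t"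
    and "\<exists>r. 0 < r \<and> r < 1 \<and>
           Limsup (at 0) (\<lambda>t. ereal (ln (\<omega> (r * t)) / ln (\<omega> t))) = \<infinity>"
    and "0 < p"
  shows "\<exists>(K :: nat \<Rightarrow> nat) (Q :: nat \<Rightarrow> real \<Rightarrow> real).
           (\<forall>n. 0 < K n) \<and> filterlim K at_top sequentially \<and>
           (\<forall>n. Q n \<in> trig_polys (K n)) \<and>
           filterlim (\<lambda>n. Lp_norm p \<omega> (deriv (Q n)) / (real (K n) * Lp_norm p \<omega> (Q n)))
             at_top sequentially"
proof (rule ccontr)
  assume fails: "\<not> ?thesis"
  note cont = assms(2)
  have nn: "0 \<le> \<omega> t" for t using assms(1) by (simp add: weight_def)
  \<comment> \<open>otherwise, choosing for each \<open>n\<close> a degree above \<open>n\<close> and a polynomial that violates the constant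
    \<open>n + 1\<close> would produce the sequences sought\<close>
  have "\<exists>n::nat. \<forall>K>n. \<forall>Q\<in>trig_polys K. 0 < Lp_norm p \<omega> Q \<longrightarrow>
          Lp_norm p \<omega> (deriv Q) \<le> (real n + 1) * real K * Lp_norm p \<omega> Q"
  proof (rule ccontr)
    assume "\<not> ?thesis"
    then have "\<forall>n. \<exists>K Q. n < K \<and> Q \<in> trig_polys K \<and> 0 < Lp_norm p \<omega> Q \<and>
        (real n + 1) * real K * Lp_norm p \<omega> Q < Lp_norm p \<omega> (deriv Q)"
      unfolding not_le[symmetric] by blast
    then obtain K Q where KQ: "\<And>n. n < K n" "\<And>n. Q n \<in> trig_polys (K n)" "\<And>n. 0 < Lp_norm p \<omega> (Q n)"
      "\<And>n. (real n + 1) * real (K n) * Lp_norm p \<omega> (Q n) < Lp_norm p \<omega> (deriv (Q n))"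
      by metis
    have pos: "0 < K n" for n using KQ(1)[of n] by simp
    have "filterlim K at_top sequentially"
      by (rule filterlim_at_top_mono[OF filterlim_ident always_eventually]) (use KQ(1) in \<open>auto intro: less_imp_le\<close>)
    moreover have "filterlim (\<lambda>n. Lp_norm p \<omega> (deriv (Q n)) / (real (K n) * Lp_norm p \<omega> (Q n))) at_top sequentially"
    proof (rule filterlim_at_top_mono[OF filterlim_real_sequentially], rule always_eventually, rule allI)
      fix n
      have "0 < real (K n) * Lp_norm p \<omega> (Q n)" using pos KQ(3) by simp
      moreover have "real n * (real (K n) * Lp_norm p \<omega> (Q n)) \<le> Lp_norm p \<omega> (deriv (Q n))"
        using KQ(4)[of n] calculation by (simp add: algebra_simps)
      ultimately show "real n \<le> Lp_norm p \<omega> (deriv (Q n)) / (real (K n) * Lp_norm p \<omega> (Q n))"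
        by (simp add: pos_le_divide_eq)
    qed
    ultimately show False using fails KQ(2) pos by blast
  qed
  then obtain n :: nat where n: "\<And>K Q. n < K \<Longrightarrow> Q \<in> trig_polys K \<Longrightarrow> 0 < Lp_norm p \<omega> Q \<Longrightarrow>
      Lp_norm p \<omega> (deriv Q) \<le> (real n + 1) * real K * Lp_norm p \<omega> Q"
    by blast
  define C where "C = real n + 1"
  have C: "0 < C" by (simp add: C_def)

  obtain \<epsilon>\<^sub>1 where \<epsilon>\<^sub>1: "0 < \<epsilon>\<^sub>1" "antimono_on {-\<epsilon>\<^sub>1<..<0} \<omega>" "\<omega> 0 = 0" "mono_on {0<..<\<epsilon>\<^sub>1} \<omega>"
    using assms(3) by blast
  obtain \<epsilon>\<^sub>2 where \<epsilon>\<^sub>2: "0 < \<epsilon>\<^sub>2" "\<And>t. t \<noteq> 0 \<Longrightarrow> \<bar>t\<bar> < \<epsilon>\<^sub>2 \<Longrightarrow> 0 < \<omega> t"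
    using assms(4) unfolding eventually_at by (auto simp: dist_real_def)
  define \<epsilon> where "\<epsilon> = min 1 (min \<epsilon>\<^sub>1 \<epsilon>\<^sub>2)"
  have \<epsilon>: "0 < \<epsilon>" "\<epsilon> \<le> pi" using \<epsilon>\<^sub>1 \<epsilon>\<^sub>2 pi_gt3 by (auto simp: \<epsilon>_def)
  have pos: "0 < \<omega> t" "0 < \<omega> (- t)" if "0 < t" "t < \<epsilon>" for t
    using that \<epsilon>\<^sub>2(2)[of t] \<epsilon>\<^sub>2(2)[of "- t"] by (auto simp: \<epsilon>_def)
  have bern: "Lp_norm p \<omega> (deriv Q) \<le> C * real K * Lp_norm p \<omega> Q"
    if "Suc n \<le> K" "Q \<in> trig_polys K" for K Q
    by (rule bernstein_norm_zero[OF cont nn \<open>0 < p\<close> \<epsilon> _ _ _ that(2)])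
       (use that C n[of K] pos in \<open>auto simp: C_def\<close>)
  obtain q B where T: "translation_estimate \<omega> q C (Suc n) B" and q: "0 < q" and B: "0 < B"
  proof (cases p)
    case (real q)
    with \<open>0 < p\<close> have q: "0 < q" by simp
    have "(1/2) powr q < 1" using q powr_less_mono2[of q "1/2" 1] by simp
    then have "0 < 4 powr q / (1 - (1/2) powr q) * pi" by simp
    with translation_estimate_finite[OF cont nn q C bern[unfolded real]] show thesis using that q by blast
  next
    case top
    with translation_estimate_infinity[OF cont nn C] bern show thesis
      using that[of 1 2] by (simp add: top_ennreal_def)
  qed

  obtain r where r: "0 < r" "r < 1" "Limsup (at 0) (\<lambda>t. ereal (ln (\<omega> (r * t)) / ln (\<omega> t))) = \<infinity>"
    using assms(5) by blast
  from Limsup_infinity_one_side[OF r(3)] show False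
  proof
    assume "\<forall>N. \<forall>\<tau>>0. \<exists>t. 0 < t \<and> t < \<tau> \<and> N < ln (\<omega> (r * t)) / ln (\<omega> t)"
    moreover have "mono_on {0<..<\<epsilon>} \<omega>"
      by (rule monotone_on_subset[OF \<epsilon>\<^sub>1(4)]) (auto simp: \<epsilon>_def)
    ultimately show False
      by (intro translation_estimate_contradicts_limsup[OF T q C B nn cont \<epsilon>(1) _ \<epsilon>\<^sub>1(3) pos(1) r(1,2)]) auto
  next
    assume unb: "\<forall>N. \<forall>\<tau>>0. \<exists>t. 0 < t \<and> t < \<tau> \<and> N < ln (\<omega> (r * - t)) / ln (\<omega> (- t))"
    have "mono_on {0<..<\<epsilon>} (\<lambda>t. \<omega> (- t))"
      using monotone_onD[OF \<epsilon>\<^sub>1(2)] by (intro mono_onI) (auto simp: \<epsilon>_def)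
    moreover have "continuous_on UNIV (\<lambda>t. \<omega> (- t))"
      by (rule continuous_on_compose2[OF cont]) (auto intro: continuous_intros)
    ultimately show False
      using unb nn pos(2) \<epsilon>\<^sub>1(3)
      by (intro translation_estimate_contradicts_limsup[OF translation_estimate_reflect[OF T] q C B _ _ \<epsilon>(1) _ _ _ r(1,2)]) auto
  qed
qed

end
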